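(* Let $\Omega\subset\mathbb{R}^n$ be a closed parametric $C^1$ curve. Let $f,c\in H^{-1}(\Omega)$ with $c\geq 0$ and $\int_\Omega c>0$. Then there exists a unique weak solution $u\in H^1(\Omega)$ to $$-\Delta u+c\cdot u=f\quad\text{on }\Omega,$$ where $\Delta$ is the Laplace-Beltrami operator on $\Omega$; that is, there is exactly one $u\in H^1(\Omega)$ such that $$\int_\Omega\langle\nabla u,\nabla v\rangle\,dx+\int_\Omega c\,u\,v\,dx=\int_\Omega f\,v\,dx\qquad\text{for all }v\in H^1(\Omega).$$
   Context: A real algebraic curve $\Omega\subset\mathbb{R}^n$ (a one-dimensional connected real solution set of a system of polynomial equations) is a closed parametric $C^k$ curve if there exist a closed interval $[a,b]\subset\mathbb{R}$ and a surjective map $X:[a,b]\to\Omega$ which is $k$-times continuously differentiable on $[a,b]$ and satisfies $X^{(r)}(a)=X^{(r)}(b)$ for all $0\le r\le k$. The map $X$ need not be injective on $[a,b)$, so $\Omega$ may have singular points such as self-intersections. Functions on $\Omega$ are understood through the parameterization: a function may take different values at a singular point along the different branches of the curve passing through it, but it is treated as a function along the parameterized closed curve. Concretely, let $L=\int_a^b\|X'(t)\|\,dt>0$ and let $s(t)=\int_a^t\|X'(\tau)\|\,d\tau$ be the arc length. Functions on $\Omega$ are functions of the arc-length variable $s\in\mathbb{R}/L\mathbb{Z}$, integration $\int_\Omega\cdot\,dx$ is integration in $s$ over $\mathbb{R}/L\mathbb{Z}$, $\nabla u$ is the derivative of $u$ with respect to arc length, and $\Delta u$ is the second derivative with respect to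 arc length. $H^1(\Omega)$ is the Sobolev space of square-integrable functions on $\mathbb{R}/L\mathbb{Z}$ with square-integrable weak derivative, with inner product $\int_\Omega\langle\nabla u,\nabla v\rangle\,dx+\int_\Omega uv\,dx$, and $H^{-1}(\Omega)$ is its dual. For $f,c\in H^{-1}(\Omega)$, the expressions $\int_\Omega fv\,dx$, $\int_\Omega cuv\,dx$ and $\int_\Omega c$ denote the dual pairings of $f$ with $v$, of $c$ with the product $uv\in H^1(\Omega)$, and of $c$ with the constant function $1$; $c\ge0$ means that the pairing of $c$ with every nonnegative function in $H^1(\Omega)$ is nonnegative. *)

theory Defs
  imports
    "HOL-Analysis.Analysis"
    "HOL-Library.Extended_Nat"
    "HOL-Library.Periodic_Fun"
begin

section \<open>Closed parametric real algebraic curves\<close>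

definition algebraic_set :: "(real ^ 'n) set \<Rightarrow> bool" where
  "algebraic_set S \<longleftrightarrow>
     (\<exists>P. finite P \<and> (\<forall>p\<in>P. real_polynomial_function p) \<and> S = {x. \<forall>p\<in>P. p x = 0})"

definition irreducible_algebraic_set :: "(real ^ 'n) set \<Rightarrow> bool" where
  "irreducible_algebraic_set Z \<longleftrightarrow> algebraic_set Z \<and> Z \<noteq> {} \<and>
     (\<forall>A B. algebraic_set A \<and> algebraic_set B \<and> Z = A \<union> B \<longrightarrow> Z = A \<or> Z = B)"

text \<open>The Krull dimension for the Zariski topology: the largest length \<open>d\<close> of a chain
  \<open>Z 0 \<subset> \<dots> \<subset> Z d\<close> of irreducible algebraic subsets.
  As a supremum in \<^typ>\<open>enat\<close> it gives the empty set dimension 0.\<close>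

definition algebraic_dim :: "(real ^ 'n) set \<Rightarrow> enat" where
  "algebraic_dim S = Sup {enat d | d. \<exists>Z.
     (\<forall>i\<le>d. irreducible_algebraic_set (Z i) \<and> Z i \<subseteq> S) \<and> (\<forall>i<d. Z i \<subset> Z (Suc i))}"

definition real_algebraic_curve :: "(real ^ 'n) set \<Rightarrow> bool" where
  "real_algebraic_curve \<Omega> \<longleftrightarrow> algebraic_set \<Omega> \<and> connected \<Omega> \<and> algebraic_dim \<Omega> = 1"

text \<open>The \<open>r\<close>-th derivative on \<open>[a,b]\<close>, one-sided at the end points.\<close>

definition nth_deriv_on ::
    "real \<Rightarrow> real \<Rightarrow> nat \<Rightarrow> (real \<Rightarrow> 'a::real_normed_vector) \<Rightarrow> real \<Rightarrow> 'a" where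
  "nth_deriv_on a b r X = ((\<lambda>Y t. vector_derivative Y (at t within {a..b})) ^^ r) X"

text \<open>\<open>X\<close> need not be injective on \<open>[a,b)\<close>, nor regular (\<open>X'\<close> may vanish).\<close>

definition closed_parametrization ::
    "nat \<Rightarrow> real \<Rightarrow> real \<Rightarrow> (real \<Rightarrow> real ^ 'n) \<Rightarrow> (real ^ 'n) set \<Rightarrow> bool" where
  "closed_parametrization k a b X \<Omega> \<longleftrightarrow> a < b \<and> X ` {a..b} = \<Omega> \<and>
     (\<forall>r<k. \<forall>t\<in>{a..b}. nth_deriv_on a b r X differentiable (at t within {a..b})) \<and>
     continuous_on {a..b} (nth_deriv_on a b k X) \<and>
     (\<forall>r\<le>k. nth_deriv_on a b r X a = nth_deriv_on a b r X b)"

definition curve_length :: "real \<Rightarrow> real \<Rightarrow> (real \<Rightarrow> real ^ 'n) \<Rightarrow> real" where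
  "curve_length a b X = integral {a..b} (\<lambda>t. norm (vector_derivative X (at t within {a..b})))"


section \<open>Sobolev spaces on the circle of length L\<close>

text \<open>Functions of the arc-length variable in \<open>\<real>/L\<int>\<close> are represented by \<open>L\<close>-periodic functions
  on the real line. Elements of the spaces below are functions rather than classes modulo equality
  almost everywhere, so that two of them are the same element of the space iff they agree almost
  everywhere.\<close>

definition circle_integral :: "real \<Rightarrow> (real \<Rightarrow> real) \<Rightarrow> real" where
  "circle_integral L g = (LINT s:{0..<L}|lebesgue. g s)"

definition L2_circle :: "real \<Rightarrow> (real \<Rightarrow> real) set" where
  "L2_circle L = {u. periodic_fun_simple u L \<and> u \<in> borel_measurable lebesgue \<and>
     set_integrable lebesgue {0..<L} (\<lambda>s. (u s)\<^sup>2)}"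

definition smooth_circle :: "real \<Rightarrow> (real \<Rightarrow> real) set" where
  "smooth_circle L = {\<phi>. periodic_fun_simple \<phi> L \<and>
     (\<forall>n s. (deriv ^^ n) \<phi> field_differentiable (at s))}"

text \<open>The circle has no boundary, so all smooth functions on it serve as test functions.\<close>

definition has_weak_deriv :: "real \<Rightarrow> (real \<Rightarrow> real) \<Rightarrow> (real \<Rightarrow> real) \<Rightarrow> bool" where
  "has_weak_deriv L u g \<longleftrightarrow> u \<in> L2_circle L \<and> g \<in> L2_circle L \<and>
     (\<forall>\<phi>\<in>smooth_circle L.
        circle_integral L (\<lambda>s. u s * deriv \<phi> s) = - circle_integral L (\<lambda>s. g s * \<phi> s))"

definition H1 :: "real \<Rightarrow> (real \<Rightarrow> real) set" where
  "H1 L = {u. \<exists>g. has_weak_deriv L u g}"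

text \<open>Weak derivatives are unique up to null sets; the integrals below do not depend on the
  choice.\<close>

definition weak_deriv :: "real \<Rightarrow> (real \<Rightarrow> real) \<Rightarrow> real \<Rightarrow> real" where
  "weak_deriv L u = (SOME g. has_weak_deriv L u g)"

definition H1_inner :: "real \<Rightarrow> (real \<Rightarrow> real) \<Rightarrow> (real \<Rightarrow> real) \<Rightarrow> real" where
  "H1_inner L u v = circle_integral L (\<lambda>s. weak_deriv L u s * weak_deriv L v s)
                  + circle_integral L (\<lambda>s. u s * v s)"

definition H1_norm :: "real \<Rightarrow> (real \<Rightarrow> real) \<Rightarrow> real" where
  "H1_norm L u = sqrt (H1_inner L u u)"

text \<open>The dual \<open>H\<^sup>-\<^sup>1\<close>: bounded linear functionals on \<^const>\<open>H1\<close>. Linearity and boundedness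
  force equal values on functions that agree almost everywhere. Values outside \<^const>\<open>H1\<close> are
  irrelevant.\<close>

definition H1_dual :: "real \<Rightarrow> ((real \<Rightarrow> real) \<Rightarrow> real) set" where
  "H1_dual L = {f.
     (\<forall>u\<in>H1 L. \<forall>v\<in>H1 L. f (\<lambda>s. u s + v s) = f u + f v) \<and>
     (\<forall>r. \<forall>u\<in>H1 L. f (\<lambda>s. r * u s) = r * f u) \<and>
     (\<exists>C. \<forall>u\<in>H1 L. \<bar>f u\<bar> \<le> C * H1_norm L u)}"

definition H1_dual_nonneg :: "real \<Rightarrow> ((real \<Rightarrow> real) \<Rightarrow> real) \<Rightarrow> bool" where
  "H1_dual_nonneg L c \<longleftrightarrow> (\<forall>v\<in>H1 L. (AE s in lebesgue. 0 \<le> v s) \<longrightarrow> 0 \<le> c v)"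

text \<open>Weak solutions of \<open>- \<Delta> u + c u = f\<close>, where the product \<open>c u\<close> is the functional
  \<open>v \<mapsto> c (u v)\<close>.\<close>

definition weak_solution ::
    "real \<Rightarrow> ((real \<Rightarrow> real) \<Rightarrow> real) \<Rightarrow> ((real \<Rightarrow> real) \<Rightarrow> real) \<Rightarrow> (real \<Rightarrow> real) \<Rightarrow> bool" where
  "weak_solution L c f u \<longleftrightarrow> u \<in> H1 L \<and>
     (\<forall>v\<in>H1 L. circle_integral L (\<lambda>s. weak_deriv L u s * weak_deriv L v s)
               + c (\<lambda>s. u s * v s) = f v)"

end

theory Submission
  imports Defs
begin

text \<open>The energy form \<open>Q u v = \<integral> u' v' + c (u v)\<close> is coercive on \<open>H\<^sup>1\<close> of the circle: an \<open>H\<^sup>1\<close> function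
  is absolutely continuous, so its oscillation is at most \<open>sqrt L\<close> times the \<open>L\<^sup>2\<close> norm of its
  derivative, and a nonnegative functional \<open>c\<close> with \<open>c 1 > 0\<close> controls its minimum. Hence
  \<open>Q\<close> is a Hilbert space structure on \<open>H\<^sup>1\<close>, and the weak solution is the Riesz representative of
  \<open>f\<close>. The length \<open>L\<close> is positive because for \<open>L \<le> 0\<close> the \<open>H\<^sup>1\<close> norm vanishes identically
  and \<open>c 1\<close> would be \<open>0\<close>.\<close>

section \<open>Quadratic forms and square-integrable functions\<close>

text \<open>Members of \<open>H1 L\<close> are functions rather than classes, so \<open>Q\<close> is
  only semidefinite on them: it vanishes on every member that is zero almost everywhere. The
  representation theorem is therefore proved for positive semidefinite forms, with completeness in
  the seminorm as a hypothesis. Definiteness enters only for uniqueness, in the form of equality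
  almost everywhere.

  Two objects resist direct estimates: \<open>weak_deriv\<close> is an arbitrary choice, and
  \<open>c\<close> need not have a density. Both become tractable through an absolutely continuous
  representative \<open>v\<close> with derivative \<open>g\<close>, because integrals ignore null
  sets and bounded functionals respect equality almost everywhere. Pointwise inequalities between
  representatives then become inequalities for \<open>c\<close> by positivity. The analytic core is
  the existence of \<open>v\<close>, which is du Bois-Reymond's lemma on the circle; the fundamental
  lemma of the calculus of variations behind it needs only trigonometric polynomials as test
  functions.\<close>

lemma quadratic_nonneg_discriminant:
  fixes a b c :: real
  assumes nonneg: "\<And>t. 0 \<le> a + 2 * t * b + t\<^sup>2 * c" and "0 \<le> c"
  shows "b\<^sup>2 \<le> a * c"
proof (cases "c = 0")
  case True
  have "b = 0"
  proof (rule ccontr)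
    assume "b \<noteq> 0"
    \<comment> \<open>An affine function of \<open>t\<close> that is bounded below is constant: at
      this \<open>t\<close> the expression would be \<open>-1\<close>. The case \<open>c = 0\<close>
      does occur, since the forms below are only semidefinite.\<close>
    then show False using nonneg[of "- (a + 1) / (2 * b)"] True by (simp add: field_simps)
  qed
  then show ?thesis using True by simp
next
  case False
  then have c: "0 < c" using assms(2) by simp
  have "0 \<le> a - b\<^sup>2 / c" using nonneg[of "- b / c"] c by (simp add: field_simps power2_eq_square)
  then show ?thesis using c by (simp add: field_simps)
qed

text \<open>Instantiated twice: with the product of square-integrable functions, which yields the
  Cauchy-Schwarz inequality for integrals, and with the energy form on \<open>H1 L\<close>.
  Linearity is asked for in the first argument; symmetry supplies the second.\<close>

locale quadratic_form =
  fixes V :: "('a \<Rightarrow> real) set" and B :: "('a \<Rightarrow> real) \<Rightarrow> ('a \<Rightarrow> real) \<Rightarrow> real"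
  assumes nonempty: "V \<noteq> {}"
    and comb: "u \<in> V \<Longrightarrow> v \<in> V \<Longrightarrow> (\<lambda>x. p * u x + q * v x) \<in> V"
    and sym: "u \<in> V \<Longrightarrow> v \<in> V \<Longrightarrow> B u v = B v u"
    and lin: "u \<in> V \<Longrightarrow> v \<in> V \<Longrightarrow> w \<in> V \<Longrightarrow>
      B (\<lambda>x. p * u x + q * v x) w = p * B u w + q * B v w"
    and nonneg: "u \<in> V \<Longrightarrow> 0 \<le> B u u"
begin

lemma diff: "u \<in> V \<Longrightarrow> v \<in> V \<Longrightarrow> (\<lambda>x. u x - v x) \<in> V"
  using comb[of u v 1 "-1"] by simp

lemma diff_left: "u \<in> V \<Longrightarrow> v \<in> V \<Longrightarrow> w \<in> V \<Longrightarrow> B (\<lambda>x. u x - v x) w = B u w - B v w"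
  using lin[of u v w 1 "-1"] by simp

lemma expand:
  assumes [simp]: "u \<in> V" "v \<in> V"
  shows "B (\<lambda>x. p * u x + q * v x) (\<lambda>x. p * u x + q * v x)
    = p\<^sup>2 * B u u + 2 * p * q * B u v + q\<^sup>2 * B v v"
proof -
  have *: "B w (\<lambda>x. p * u x + q * v x) = p * B u w + q * B v w" if "w \<in> V" for w
    using sym[OF that comb[of u v p q]] lin[of u v w p q] that by simp
  show ?thesis
    using lin[of u v "\<lambda>x. p * u x + q * v x" p q] *[of u] *[of v] sym[of u v] comb[of u v p q]
    by (simp add: algebra_simps power2_eq_square)
qed

lemma Cauchy_Schwarz:
  assumes "u \<in> V" "v \<in> V"
  shows "(B u v)\<^sup>2 \<le> B u u * B v v"
proof (rule quadratic_nonneg_discriminant)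
  fix t
  show "0 \<le> B u u + 2 * t * B u v + t\<^sup>2 * B v v"
    using nonneg[OF comb[OF assms, of 1 t]] expand[OF assms, of 1 t] by simp
qed (use nonneg assms in auto)

text \<open>A minimising sequence of \<open>v \<mapsto> B v v - 2 * F v\<close> is Cauchy by the parallelogram law, and
  the first-order condition at each of its members passes to the limit.\<close>

theorem Riesz_representation:
  fixes F :: "('a \<Rightarrow> real) \<Rightarrow> real"
  assumes F_lin: "\<And>u v p q. u \<in> V \<Longrightarrow> v \<in> V \<Longrightarrow> F (\<lambda>x. p * u x + q * v x) = p * F u + q * F v"
    and F_bound: "\<And>v. v \<in> V \<Longrightarrow> (F v)\<^sup>2 \<le> K * B v v"
    and complete: "\<And>X. (\<And>n. X n \<in> V) \<Longrightarrow>
      (\<And>e. e > 0 \<Longrightarrow> \<exists>N. \<forall>m\<ge>N. \<forall>n\<ge>N. B (\<lambda>x. X m x - X n x) (\<lambda>x. X m x - X n x) < e) \<Longrightarrow>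
      \<exists>u\<in>V. (\<lambda>n. B (\<lambda>x. X n x - u x) (\<lambda>x. X n x - u x)) \<longlonglongrightarrow> 0"
  shows "\<exists>u\<in>V. \<forall>v\<in>V. B u v = F v"
proof -
  define J where "J v = B v v - 2 * F v" for v
  have J_comb: "J (\<lambda>x. p * u x + q * v x)
      = p\<^sup>2 * B u u + 2 * p * q * B u v + q\<^sup>2 * B v v - 2 * p * F u - 2 * q * F v"
    if "u \<in> V" "v \<in> V" for u v p q
    unfolding J_def expand[OF that] F_lin[OF that] by simp
  have J_bound: "- (\<bar>K\<bar> + 1) \<le> J v" if "v \<in> V" for v
  proof -
    \<comment> \<open>This number is positive whatever the sign of \<open>K\<close>. Young's
      inequality then bounds \<open>2 * F v\<close> by \<open>(F v)\<^sup>2 / ?k + ?k\<close>, and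
      the quotient is absorbed by \<open>B v v\<close>.\<close>
    let ?k = "\<bar>K\<bar> + 1"
    have "0 \<le> (F v / ?k - 1)\<^sup>2" by simp
    then have "2 * F v / ?k \<le> (F v)\<^sup>2 / ?k\<^sup>2 + 1"
      by (simp add: power2_diff power_divide)
    then have "2 * F v / ?k * ?k \<le> ((F v)\<^sup>2 / ?k\<^sup>2 + 1) * ?k"
      by (intro mult_right_mono) auto
    also have "\<dots> = (F v)\<^sup>2 / ?k + ?k"
    proof -
      have "(F v)\<^sup>2 / ?k\<^sup>2 * ?k = (F v)\<^sup>2 / ?k" by (simp add: power2_eq_square)
      then show ?thesis by (simp only: distrib_right mult_1)
    qed
    finally have 1: "2 * F v \<le> (F v)\<^sup>2 / ?k + ?k" by simp
    have "(F v)\<^sup>2 \<le> ?k * B v v"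
      using F_bound[OF that] nonneg[OF that] mult_right_mono[of K ?k "B v v"] by linarith
    then have "(F v)\<^sup>2 / ?k \<le> B v v" by (simp add: divide_le_eq mult.commute)
    then show ?thesis using 1 unfolding J_def by linarith
  qed
  define m where "m = Inf (J ` V)"
  have bdd: "bdd_below (J ` V)" using J_bound by (auto intro!: bdd_belowI)
  have m_le: "m \<le> J v" if "v \<in> V" for v unfolding m_def using bdd that by (intro cINF_lower)
  have "\<exists>v\<in>V. J v < m + 1 / real (Suc n)" for n
  proof -
    have "Inf (J ` V) < m + 1 / real (Suc n)" unfolding m_def by simp
    from cInf_lessD[OF _ this] show ?thesis using nonempty by auto
  qed
  then obtain X where X: "\<And>n. X n \<in> V" and JX: "\<And>n. J (X n) < m + 1 / real (Suc n)" by metis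
  \<comment> \<open>In twice \<open>J (X i)\<close> plus twice \<open>J (X j)\<close> minus four
    times \<open>J\<close> at the midpoint, the terms with \<open>F\<close> cancel and the square of
    the difference remains. The midpoint value is at least \<open>m\<close>, and the other two
    exceed \<open>m\<close> by less than \<open>1 / Suc i\<close> and
    \<open>1 / Suc j\<close>.\<close>
  have sq: "B (\<lambda>x. X i x - X j x) (\<lambda>x. X i x - X j x) \<le> 2 / real (Suc i) + 2 / real (Suc j)" for i j
  proof -
    have "m \<le> J (\<lambda>x. 1/2 * X i x + 1/2 * X j x)" by (intro m_le comb X)
    moreover have "B (\<lambda>x. X i x - X j x) (\<lambda>x. X i x - X j x)
      = 2 * J (X i) + 2 * J (X j) - 4 * J (\<lambda>x. 1/2 * X i x + 1/2 * X j x)"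
      using expand[OF X X, of 1 i "-1" j]
      unfolding J_comb[OF X X] J_def by (simp add: algebra_simps power2_eq_square)
    ultimately show ?thesis using JX[of i] JX[of j] by (simp del: of_nat_Suc)
  qed
  have lim0: "(\<lambda>n. 1 / real (Suc n)) \<longlonglongrightarrow> 0"
    using LIMSEQ_inverse_real_of_nat by (simp add: inverse_eq_divide)
  have "\<exists>u\<in>V. (\<lambda>n. B (\<lambda>x. X n x - u x) (\<lambda>x. X n x - u x)) \<longlonglongrightarrow> 0"
  proof (rule complete[OF X])
    fix e :: real assume "e > 0"
    then have "\<forall>\<^sub>F n in sequentially. 1 / real (Suc n) < e / 4"
      using order_tendstoD(2)[OF lim0, of "e/4"] by simp
    then obtain N where N: "\<And>n. n \<ge> N \<Longrightarrow> 1 / real (Suc n) < e / 4"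
      unfolding eventually_sequentially by blast
    show "\<exists>N. \<forall>m\<ge>N. \<forall>n\<ge>N. B (\<lambda>x. X m x - X n x) (\<lambda>x. X m x - X n x) < e"
    proof (intro exI allI impI)
      fix i j assume "N \<le> i" "N \<le> j"
      from N[OF this(1)] N[OF this(2)] sq[of i j]
      show "B (\<lambda>x. X i x - X j x) (\<lambda>x. X i x - X j x) < e" by (simp del: of_nat_Suc)
    qed
  qed
  then obtain u where u: "u \<in> V" and
    lim: "(\<lambda>n. B (\<lambda>x. X n x - u x) (\<lambda>x. X n x - u x)) \<longlonglongrightarrow> 0" by blast
  have "B u v = F v" if v: "v \<in> V" for v
  proof -
    have "(\<lambda>n. B (X n) v - B u v) \<longlonglongrightarrow> 0"
    proof (rule Lim_null_comparison)
      show "(\<lambda>n. sqrt (B (\<lambda>x. X n x - u x) (\<lambda>x. X n x - u x) * B v v)) \<longlonglongrightarrow> 0"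
        using tendsto_real_sqrt[OF tendsto_mult_right[OF lim, of "B v v"]] by simp
      show "\<forall>\<^sub>F n in sequentially. norm (B (X n) v - B u v)
          \<le> sqrt (B (\<lambda>x. X n x - u x) (\<lambda>x. X n x - u x) * B v v)"
        using Cauchy_Schwarz[OF diff[OF X u] v] diff_left[OF X u v]
        by (intro always_eventually allI) (auto intro!: real_le_rsqrt)
    qed
    then have Bv: "(\<lambda>n. B (X n) v) \<longlonglongrightarrow> B u v" by (simp add: LIM_zero_iff)
    \<comment> \<open>\<open>X n\<close> is within \<open>1 / Suc n\<close> of the infimum, so a
      move by \<open>t * v\<close> lowers \<open>J\<close> by at most that amount. In the limit the
      quadratic in \<open>t\<close> has constant term \<open>0\<close>, and the discriminant bound
      kills its linear coefficient.\<close>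
    have "(B u v - F v)\<^sup>2 \<le> 0 * B v v"
    proof (rule quadratic_nonneg_discriminant)
      fix t
      have "0 \<le> 1 / real (Suc n) + 2 * t * (B (X n) v - F v) + t\<^sup>2 * B v v" for n
        using m_le[OF comb[OF X[of n] v, of 1 t]] JX[of n] unfolding J_comb[OF X v]
        by (simp add: J_def algebra_simps)
      moreover have "(\<lambda>n. 1 / real (Suc n) + 2 * t * (B (X n) v - F v) + t\<^sup>2 * B v v)
          \<longlonglongrightarrow> 0 + 2 * t * (B u v - F v) + t\<^sup>2 * B v v"
        by (intro tendsto_intros lim0 Bv)
      ultimately show "0 \<le> 0 + 2 * t * (B u v - F v) + t\<^sup>2 * B v v"
        by (intro tendsto_lowerbound[where F=sequentially]) auto
    qed (use nonneg v in auto)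
    then show ?thesis by simp
  qed
  with u show ?thesis by blast
qed

end

section \<open>Square-integrable functions and their completeness\<close>

definition square_integrable :: "'a measure \<Rightarrow> ('a \<Rightarrow> real) \<Rightarrow> bool" where
  "square_integrable M f \<longleftrightarrow> f \<in> borel_measurable M \<and> integrable M (\<lambda>x. (f x)\<^sup>2)"

lemma square_integrable_measurable [measurable_dest]:
  "square_integrable M f \<Longrightarrow> f \<in> borel_measurable M"
  by (simp add: square_integrable_def)

lemma square_integrable_mult:
  assumes "square_integrable M f" "square_integrable M g"
  shows "integrable M (\<lambda>x. f x * g x)"
proof (rule Bochner_Integration.integrable_bound)
  note [measurable] = assms[THEN square_integrable_measurable]
  show "integrable M (\<lambda>x. (f x)\<^sup>2 + (g x)\<^sup>2)" using assms by (simp add: square_integrable_def)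
  show "(\<lambda>x. f x * g x) \<in> borel_measurable M" by measurable
  have "\<bar>p * q\<bar> \<le> p\<^sup>2 + q\<^sup>2" for p q :: real
  proof -
    have "2 * \<bar>p * q\<bar> \<le> p\<^sup>2 + q\<^sup>2"
      using sum_squares_bound[of "\<bar>p\<bar>" "\<bar>q\<bar>"] by (simp add: abs_mult mult.assoc)
    then show ?thesis by linarith
  qed
  then show "AE x in M. norm (f x * g x) \<le> norm ((f x)\<^sup>2 + (g x)\<^sup>2)" by simp
qed

lemma square_integrable_comb:
  assumes "square_integrable M f" "square_integrable M g"
  shows "square_integrable M (\<lambda>x. p * f x + q * g x)"
proof -
  have "integrable M (\<lambda>x. p\<^sup>2 * (f x)\<^sup>2 + 2 * p * q * (f x * g x) + q\<^sup>2 * (g x)\<^sup>2)"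
    using assms square_integrable_mult[OF assms] by (simp add: square_integrable_def)
  also have "(\<lambda>x. p\<^sup>2 * (f x)\<^sup>2 + 2 * p * q * (f x * g x) + q\<^sup>2 * (g x)\<^sup>2) = (\<lambda>x. (p * f x + q * g x)\<^sup>2)"
    by (simp add: power2_eq_square algebra_simps)
  finally have "integrable M (\<lambda>x. (p * f x + q * g x)\<^sup>2)" .
  moreover note [measurable] = assms[THEN square_integrable_measurable]
  have "(\<lambda>x. p * f x + q * g x) \<in> borel_measurable M" by measurable
  ultimately show ?thesis by (simp add: square_integrable_def)
qed

lemma square_integrable_diff:
  "square_integrable M f \<Longrightarrow> square_integrable M g \<Longrightarrow> square_integrable M (\<lambda>x. f x - g x)"
  using square_integrable_comb[of M f g 1 "-1"] by simp

lemma square_integrable_add: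
  "square_integrable M f \<Longrightarrow> square_integrable M g \<Longrightarrow> square_integrable M (\<lambda>x. f x + g x)"
  using square_integrable_comb[of M f g 1 1] by simp

lemma (in finite_measure) square_integrable_bounded:
  assumes [measurable]: "f \<in> borel_measurable M" and bd: "\<And>x. x \<in> space M \<Longrightarrow> \<bar>f x\<bar> \<le> C"
  shows "square_integrable M f"
proof -
  have "integrable M (\<lambda>x. (f x)\<^sup>2)"
  proof (rule integrable_const_bound[where B="C\<^sup>2"])
    have "(f x)\<^sup>2 \<le> C\<^sup>2" if "x \<in> space M" for x
      using power_mono[OF bd[OF that], of 2] by simp
    then show "AE x in M. norm ((f x)\<^sup>2) \<le> C\<^sup>2" by auto
  qed measurable
  then show ?thesis by (simp add: square_integrable_def)
qed

lemma (in finite_measure) square_integrable_integrable: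
  assumes "square_integrable M f" shows "integrable M f"
  using square_integrable_mult[OF assms square_integrable_bounded[of "\<lambda>_. 1" 1]] by simp

lemma square_integrable_times_bounded:
  assumes f: "square_integrable M f" and [measurable]: "h \<in> borel_measurable M"
    and bd: "\<And>x. x \<in> space M \<Longrightarrow> \<bar>h x\<bar> \<le> C"
  shows "square_integrable M (\<lambda>x. h x * f x)"
proof -
  note [measurable] = square_integrable_measurable[OF f]
  have "integrable M (\<lambda>x. (h x * f x)\<^sup>2)"
  proof (rule Bochner_Integration.integrable_bound)
    show "integrable M (\<lambda>x. C\<^sup>2 * (f x)\<^sup>2)" using f by (simp add: square_integrable_def)
    have "(h x * f x)\<^sup>2 \<le> C\<^sup>2 * (f x)\<^sup>2" if "x \<in> space M" for x
      using power_mono[OF bd[OF that], of 2] by (simp add: power_mult_distrib mult_right_mono)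
    then show "AE x in M. norm ((h x * f x)\<^sup>2) \<le> norm (C\<^sup>2 * (f x)\<^sup>2)" by auto
  qed measurable
  then show ?thesis by (simp add: square_integrable_def)
qed

lemma quadratic_form_square_integrable:
  "quadratic_form {f. square_integrable M f} (\<lambda>f g. LINT x|M. f x * g x)"
proof
  show "{f. square_integrable M f} \<noteq> {}"
    using square_integrable_def[of M "\<lambda>_. 0"] by auto
  fix f g h :: "'a \<Rightarrow> real" and p q
  assume "f \<in> {f. square_integrable M f}" "g \<in> {f. square_integrable M f}"
    "h \<in> {f. square_integrable M f}"
  then show "(LINT x|M. (p * f x + q * g x) * h x) = p * (LINT x|M. f x * h x) + q * (LINT x|M. g x * h x)"
    by (simp add: distrib_right mult.assoc square_integrable_mult)
qed (auto simp: square_integrable_comb mult.commute)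

lemma integral_Cauchy_Schwarz:
  assumes "square_integrable M f" "square_integrable M g"
  shows "(LINT x|M. f x * g x)\<^sup>2 \<le> (LINT x|M. (f x)\<^sup>2) * (LINT x|M. (g x)\<^sup>2)"
  using quadratic_form.Cauchy_Schwarz[OF quadratic_form_square_integrable, of f M g] assms
  by (simp add: power2_eq_square)

lemma (in finite_measure) integral_square_bound:
  assumes "square_integrable M f"
  shows "(LINT x|M. \<bar>f x\<bar>)\<^sup>2 \<le> measure M (space M) * (LINT x|M. (f x)\<^sup>2)"
proof -
  note [measurable] = square_integrable_measurable[OF assms]
  have "square_integrable M (\<lambda>x. \<bar>f x\<bar>)" using assms by (simp add: square_integrable_def)
  from integral_Cauchy_Schwarz[OF square_integrable_bounded[of "\<lambda>_. 1" 1] this]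
  show ?thesis by simp
qed

text \<open>On a finite measure space a sequence that is Cauchy in mean square is Cauchy in mean, so
  a subsequence converges almost everywhere. Fatou's lemma along this subsequence bounds the
  mean-square distance of the whole sequence to the pointwise limit.\<close>

lemma (in finite_measure) L2_complete:
  assumes f: "\<And>n. square_integrable M (f n)"
    and cauchy: "\<And>e. e > 0 \<Longrightarrow> \<exists>N. \<forall>m\<ge>N. \<forall>n\<ge>N. (LINT x|M. (f m x - f n x)\<^sup>2) < e"
  shows "\<exists>g. square_integrable M g \<and> (\<lambda>n. LINT x|M. (f n x - g x)\<^sup>2) \<longlonglongrightarrow> 0"
proof -
  note [measurable] = square_integrable_measurable[OF f]
  \<comment> \<open>The summand \<open>1\<close> keeps the division by \<open>\<mu>\<close>
    legitimate when the space has measure zero.\<close>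
  define \<mu> where "\<mu> = measure M (space M) + 1"
  have \<mu>: "\<mu> > 0" unfolding \<mu>_def by (simp add: add_nonneg_pos)
  have d2: "square_integrable M (\<lambda>x. f m x - f n x)" for m n
    by (intro square_integrable_diff f)
  obtain r where r: "strict_mono r" and "AE x in M. Cauchy (\<lambda>i. f (r i) x)"
  proof (rule cauchy_L1_AE_cauchy_subseq)
    show "integrable M (f n)" for n using f by (rule square_integrable_integrable)
    fix e :: real assume e: "e > 0"
    with \<mu> obtain N where N: "\<And>m n. m \<ge> N \<Longrightarrow> n \<ge> N \<Longrightarrow> (LINT x|M. (f m x - f n x)\<^sup>2) < e\<^sup>2 / \<mu>"
      using cauchy[of "e\<^sup>2 / \<mu>"] by auto
    have "(LINT x|M. norm (f m x - f n x)) < e" if "m \<ge> N" "n \<ge> N" for m n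
    proof -
      have "(LINT x|M. \<bar>f m x - f n x\<bar>)\<^sup>2 \<le> measure M (space M) * (LINT x|M. (f m x - f n x)\<^sup>2)"
        by (rule integral_square_bound[OF d2])
      also have "\<dots> \<le> \<mu> * (LINT x|M. (f m x - f n x)\<^sup>2)"
        unfolding \<mu>_def by (intro mult_right_mono integral_nonneg_AE) auto
      also have "\<dots> < e\<^sup>2" using N[OF that] \<mu> by (simp add: field_simps)
      finally show ?thesis using e by (simp add: power2_less_imp_less)
    qed
    then show "\<exists>N. \<forall>i\<ge>N. \<forall>j\<ge>N. (LINT x|M. norm (f i x - f j x)) < e" by blast
  qed
  define g where "g x = lim (\<lambda>i. f (r i) x)" for x
  have [measurable]: "g \<in> borel_measurable M" unfolding g_def by measurable
  have lim: "AE x in M. (\<lambda>i. f (r i) x) \<longlonglongrightarrow> g x"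
    using \<open>AE x in M. Cauchy _\<close>
    by eventually_elim (simp add: g_def Cauchy_convergent_iff convergent_LIMSEQ_iff)
  \<comment> \<open>Formulated with the nonnegative integral because integrability of the limit is
    only a consequence of this bound. As \<open>r i \<ge> i\<close>, the tail estimate holds along
    the subsequence from \<open>N\<close> on.\<close>
  have bound: "(\<integral>\<^sup>+x. ennreal ((f n x - g x)\<^sup>2) \<partial>M) \<le> ennreal e"
    if e: "e > 0" and N: "\<And>m. m \<ge> N \<Longrightarrow> (LINT x|M. (f n x - f m x)\<^sup>2) < e" for n N e
  proof -
    have "(\<integral>\<^sup>+x. ennreal ((f n x - g x)\<^sup>2) \<partial>M)
      = (\<integral>\<^sup>+x. liminf (\<lambda>i. ennreal ((f n x - f (r i) x)\<^sup>2)) \<partial>M)"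
    proof (rule nn_integral_cong_AE)
      show "AE x in M. ennreal ((f n x - g x)\<^sup>2) = liminf (\<lambda>i. ennreal ((f n x - f (r i) x)\<^sup>2))"
        using lim
      proof eventually_elim
        case (elim x)
        have "(\<lambda>i. ennreal ((f n x - f (r i) x)\<^sup>2)) \<longlonglongrightarrow> ennreal ((f n x - g x)\<^sup>2)"
          by (intro tendsto_ennrealI tendsto_intros elim)
        then show ?case by (rule lim_imp_Liminf[OF trivial_limit_sequentially, symmetric])
      qed
    qed
    also have "\<dots> \<le> liminf (\<lambda>i. \<integral>\<^sup>+x. ennreal ((f n x - f (r i) x)\<^sup>2) \<partial>M)"
      by (intro nn_integral_liminf) measurable
    also have "\<dots> \<le> ennreal e"
    proof (rule Liminf_le)
      have "(\<integral>\<^sup>+x. ennreal ((f n x - f (r i) x)\<^sup>2) \<partial>M) \<le> ennreal e" if "i \<ge> N" for i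
      proof -
        have "r i \<ge> N" using strict_mono_imp_increasing[OF r, of i] that by linarith
        from less_imp_le[OF N[OF this]] show ?thesis
          using square_integrable_mult[OF d2 d2, of n "r i" n "r i"]
          by (subst nn_integral_eq_integral) (auto simp: power2_eq_square intro!: ennreal_leI)
      qed
      then show "\<forall>\<^sub>F i in sequentially. (\<integral>\<^sup>+x. ennreal ((f n x - f (r i) x)\<^sup>2) \<partial>M) \<le> ennreal e"
        unfolding eventually_sequentially by blast
    qed simp
    finally show ?thesis .
  qed
  have sq: "square_integrable M (\<lambda>x. f n x - g x)" and le: "(LINT x|M. (f n x - g x)\<^sup>2) \<le> e"
    if e: "e > 0" and N: "\<And>m. m \<ge> N \<Longrightarrow> (LINT x|M. (f n x - f m x)\<^sup>2) < e" for n N e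
  proof -
    note b = bound[OF that]
    then have int: "integrable M (\<lambda>x. (f n x - g x)\<^sup>2)"
      by (intro integrableI_bounded) (auto simp: less_top[symmetric] top_unique)
    then show "square_integrable M (\<lambda>x. f n x - g x)" by (simp add: square_integrable_def)
    show "(LINT x|M. (f n x - g x)\<^sup>2) \<le> e"
      using b e by (subst (asm) nn_integral_eq_integral[OF int]) auto
  qed
  obtain N where "\<And>m n. m \<ge> N \<Longrightarrow> n \<ge> N \<Longrightarrow> (LINT x|M. (f m x - f n x)\<^sup>2) < 1"
    using cauchy[of 1] by auto
  then have "square_integrable M (\<lambda>x. f N x - g x)" by (intro sq[where e=1 and N=N]) auto
  from square_integrable_diff[OF f[of N] this] have "square_integrable M g" by simp
  moreover have "(\<lambda>n. LINT x|M. (f n x - g x)\<^sup>2) \<longlonglongrightarrow> 0"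
  proof (rule LIMSEQ_I)
    fix e :: real assume "e > 0"
    then obtain N where N: "\<And>m n. m \<ge> N \<Longrightarrow> n \<ge> N \<Longrightarrow> (LINT x|M. (f m x - f n x)\<^sup>2) < e / 2"
      using cauchy[of "e/2"] by auto
    have "norm ((LINT x|M. (f n x - g x)\<^sup>2) - 0) < e" if "n \<ge> N" for n
      using le[of "e/2" N n] N[OF that] \<open>e > 0\<close> by simp
    then show "\<exists>no. \<forall>n\<ge>no. norm ((LINT x|M. (f n x - g x)\<^sup>2) - 0) < e" by blast
  qed
  ultimately show ?thesis by blast
qed

section \<open>Primitives on the circle\<close>

lemma lebesgue_on_ident_measurable: "(\<lambda>x. x) \<in> borel_measurable (lebesgue_on S)"
  for S :: "real set"
proof -
  have "(\<lambda>x::real. x) \<in> borel_measurable lebesgue" by (rule measurable_completion) simp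
  then show ?thesis by (rule measurable_restrict_space1)
qed

locale circle =
  fixes L :: real
  assumes L_pos: "0 < L"
begin

abbreviation M :: "real measure" where "M \<equiv> lebesgue_on {0..<L}"

sublocale finite_measure M
  using L_pos by (intro finite_measureI) (simp add: emeasure_restrict_space)

lemma measure_M: "measure M (space M) = L"
  using L_pos by (simp add: measure_restrict_space)

lemma pair_sigma_finite_M: "pair_sigma_finite M M"
  by (rule pair_sigma_finite.intro) (rule sigma_finite_measure_axioms)+

lemma circle_integral_eq: "circle_integral L f = (LINT s|M. f s)"
  by (simp add: circle_integral_def set_lebesgue_integral_def integral_restrict_space)

lemma L2_circle_iff: "u \<in> L2_circle L \<longleftrightarrow>
    periodic_fun_simple u L \<and> u \<in> borel_measurable lebesgue \<and> square_integrable M u"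
  by (auto simp: L2_circle_def square_integrable_def set_integrable_def integrable_restrict_space
      intro: measurable_restrict_space1)

lemma AE_M_iff: "(AE s in M. P s) \<longleftrightarrow> (AE s in lebesgue. s \<in> {0..<L} \<longrightarrow> P s)"
  by (rule AE_restrict_space_iff) simp

lemma AE_M_neq: "AE s in M. s \<noteq> t"
proof -
  have "AE s in lborel. s \<noteq> t" by (rule AE_lborel_singleton)
  then have "AE s in lebesgue. s \<noteq> t" by (rule AE_completion)
  then show ?thesis unfolding AE_M_iff by eventually_elim auto
qed

lemma periodic_minus:
  assumes "periodic_fun_simple u L" shows "u (s - L * of_int k) = u s"
proof -
  interpret periodic_fun_simple u L by fact
  show ?thesis using minus_of_int[of s k] by (simp add: mult.commute)
qed

text \<open>The representative of \<open>s\<close> modulo \<open>L\<close> in the fundamental domain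
  \<open>{0..<L}\<close>. Composition with it turns a function on one period into a periodic
  one.\<close>

definition wrap :: "real \<Rightarrow> real" where "wrap s = s - L * of_int \<lfloor>s / L\<rfloor>"

lemma wrap_measurable [measurable]: "wrap \<in> borel_measurable borel"
  unfolding wrap_def by measurable

lemma wrap_in: "wrap s \<in> {0..<L}"
proof -
  have "of_int \<lfloor>s / L\<rfloor> \<le> s / L" "s / L < of_int \<lfloor>s / L\<rfloor> + 1" by linarith+
  then have "of_int \<lfloor>s / L\<rfloor> * L \<le> s" "s < (of_int \<lfloor>s / L\<rfloor> + 1) * L"
    using L_pos by (simp_all only: pos_le_divide_eq pos_divide_less_eq)
  then show ?thesis by (simp add: wrap_def algebra_simps)
qed

lemma wrap_id: "s \<in> {0..<L} \<Longrightarrow> wrap s = s"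
  using L_pos by (simp add: wrap_def floor_eq_iff)

lemma periodic_wrap: "periodic_fun_simple (\<lambda>s. u (wrap s)) L"
proof
  fix s
  have "\<lfloor>(s + L) / L\<rfloor> = \<lfloor>s / L\<rfloor> + 1" using L_pos by (simp add: add_divide_distrib)
  then show "u (wrap (s + L)) = u (wrap s)" by (simp add: wrap_def algebra_simps)
qed

lemma periodic_eq_wrap: "periodic_fun_simple u L \<Longrightarrow> u (wrap s) = u s"
  unfolding wrap_def by (rule periodic_minus)

text \<open>The exceptional set on the line is covered by the translates of its part in one period
  by multiples of \<open>L\<close>, and these are countably many null sets.\<close>

lemma AE_periodic:
  assumes u: "periodic_fun_simple u L" and ae: "AE s in M. u s = 0"
  shows "AE s in lebesgue. u s = (0::real)"
proof -
  define N where "N = {s\<in>{0..<L}. u s \<noteq> 0}"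
  have "AE s in lebesgue. s \<notin> N"
    using ae unfolding AE_M_iff by eventually_elim (auto simp: N_def)
  then obtain N' where "\<And>s. s \<in> space lebesgue - N' \<Longrightarrow> s \<notin> N" and "N' \<in> null_sets lebesgue"
    using AE_E3 by metis
  then have "N \<subseteq> N'" "negligible N'" by (auto simp: negligible_iff_null_sets)
  then have "negligible N" using negligible_subset by blast
  then have "negligible (\<Union>k::int. (+) (L * of_int k) ` N)"
    by (intro negligible_countable_Union) (auto simp: negligible_translation)
  then have "AE s in lebesgue. s \<notin> (\<Union>k::int. (+) (L * of_int k) ` N)"
    unfolding negligible_iff_null_sets by (rule AE_not_in)
  then show ?thesis
  proof eventually_elim
    case (elim s)
    have "wrap s \<notin> N"
    proof
      assume "wrap s \<in> N"
      then have "s \<in> (+) (L * of_int \<lfloor>s / L\<rfloor>) ` N"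
        by (intro image_eqI[of _ _ "wrap s"]) (simp_all add: wrap_def)
      then show False using elim by blast
    qed
    then show ?case using wrap_in[of s] periodic_eq_wrap[OF u, of s] by (auto simp: N_def)
  qed
qed

text \<open>The primitive of \<open>g\<close> from \<open>0\<close>. The cut-off sits in the
  integrand, so all values are integrals against one fixed measure, which suits Fubini. Outside the
  period the function is constant: \<open>0\<close> to the left of \<open>0\<close>, the full
  integral to the right of \<open>L\<close>.\<close>

definition prim :: "(real \<Rightarrow> real) \<Rightarrow> real \<Rightarrow> real" where
  "prim g s = (LINT x|M. (if x < s then g x else 0))"

lemma integrable_less:
  assumes "integrable M g" shows "integrable M (\<lambda>x. if x < s then g x else (0::real))"
proof (rule Bochner_Integration.integrable_bound[OF assms])
  note [measurable] = borel_measurable_integrable[OF assms] lebesgue_on_ident_measurable[of "{0..<L}"]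
  show "(\<lambda>x. if x < s then g x else 0) \<in> borel_measurable M" by measurable
qed auto

lemma prim_measurable [measurable]:
  assumes "integrable M g" shows "prim g \<in> borel_measurable borel"
proof -
  note [measurable] = borel_measurable_integrable[OF assms] lebesgue_on_ident_measurable[of "{0..<L}"]
  show ?thesis unfolding prim_def by measurable
qed

lemma prim_diff_bound:
  assumes "integrable M g" shows "\<bar>prim g s - prim g t\<bar> \<le> (LINT x|M. \<bar>g x\<bar>)"
proof -
  have "prim g s - prim g t = (LINT x|M. (if x < s then g x else 0) - (if x < t then g x else 0))"
    unfolding prim_def by (intro Bochner_Integration.integral_diff[symmetric] integrable_less assms)
  then have "\<bar>prim g s - prim g t\<bar>
    = \<bar>LINT x|M. (if x < s then g x else 0) - (if x < t then g x else 0)\<bar>" by (simp only:)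
  also have "\<dots> \<le> (LINT x|M. \<bar>(if x < s then g x else 0) - (if x < t then g x else 0)\<bar>)"
    by (rule integral_abs_bound)
  also have "\<dots> \<le> (LINT x|M. \<bar>g x\<bar>)"
    by (intro integral_mono integrable_abs Bochner_Integration.integrable_diff integrable_less assms) auto
  finally show ?thesis .
qed

lemma prim_zero:
  assumes "s \<le> 0" shows "prim g s = 0"
proof -
  have "prim g s = (LINT x|M. 0)" unfolding prim_def
    using assms by (intro Bochner_Integration.integral_cong) auto
  then show ?thesis by simp
qed

lemma prim_L: "prim g L = (LINT x|M. g x)"
  unfolding prim_def by (intro Bochner_Integration.integral_cong) auto

lemma prim_cong: "(\<And>x. x \<in> {0..<L} \<Longrightarrow> x < s \<Longrightarrow> g x = h x) \<Longrightarrow> prim g s = prim h s"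
  unfolding prim_def by (intro Bochner_Integration.integral_cong) auto

lemma prim_bound: "integrable M g \<Longrightarrow> \<bar>prim g s\<bar> \<le> (LINT x|M. \<bar>g x\<bar>)"
  using prim_diff_bound[of g s 0] prim_zero[of 0 g] by simp

lemma prim_comb:
  assumes "integrable M g" "integrable M h"
  shows "prim (\<lambda>x. p * g x + q * h x) s = p * prim g s + q * prim h s"
proof -
  have "prim (\<lambda>x. p * g x + q * h x) s
    = (LINT x|M. p * (if x < s then g x else 0) + q * (if x < s then h x else 0))"
    unfolding prim_def by (intro Bochner_Integration.integral_cong) auto
  also have "\<dots> = p * prim g s + q * prim h s" unfolding prim_def
    by (subst Bochner_Integration.integral_add) (auto intro!: integrable_less assms integrable_mult_right)
  finally show ?thesis .
qed

lemma integrable_times_prim: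
  assumes "integrable M f" "integrable M g" shows "integrable M (\<lambda>x. f x * prim g x)"
proof (rule Bochner_Integration.integrable_bound)
  note [measurable] = borel_measurable_integrable[OF assms(1)] prim_measurable[OF assms(2)]
  show "integrable M (\<lambda>x. (LINT x|M. \<bar>g x\<bar>) * f x)" using assms by simp
  have "(\<lambda>x. prim g x) \<in> borel_measurable M"
    using measurable_compose[OF lebesgue_on_ident_measurable prim_measurable[OF assms(2)]] by simp
  then show "(\<lambda>x. f x * prim g x) \<in> borel_measurable M" by measurable
  have "\<bar>f x * prim g x\<bar> \<le> \<bar>(LINT x|M. \<bar>g x\<bar>) * f x\<bar>" for x
    unfolding abs_mult using prim_bound[OF assms(2), of x] by (simp add: mult_left_mono mult.commute)
  then show "AE x in M. norm (f x * prim g x) \<le> norm ((LINT x|M. \<bar>g x\<bar>) * f x)" by simp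
qed

text \<open>Integration by parts without any differentiation: the product is an integral over the
  square, the diagonal is a null set, and each of the two triangles gives one summand.\<close>

lemma integral_mult_integral:
  assumes f: "integrable M f" and k: "integrable M k"
  shows "(LINT x|M. f x) * (LINT x|M. k x) = (LINT x|M. f x * prim k x + k x * prim f x)"
proof -
  interpret P: pair_sigma_finite M M by (rule pair_sigma_finite_M)
  note [measurable] = borel_measurable_integrable[OF f] borel_measurable_integrable[OF k]
    lebesgue_on_ident_measurable[of "{0..<L}"]
  \<comment> \<open>The integrand on the triangle \<open>x < y\<close>. For fixed \<open>x\<close>
    the other triangle is \<open>f x * prim k x\<close> at once, so only this one needs the order of
    integration exchanged.\<close>
  define W where "W x y = (if x < y then f x * k y else 0)" for x y
  have [measurable]: "case_prod W \<in> borel_measurable (M \<Otimes>\<^sub>M M)" unfolding W_def by measurable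
  have Wint: "integrable (M \<Otimes>\<^sub>M M) (case_prod W)"
  proof (rule Bochner_Integration.integrable_bound)
    show "integrable (M \<Otimes>\<^sub>M M) (\<lambda>(x, y). f x * k y)"
    proof (rule P.Fubini_integrable)
      show "AE x in M. integrable M (\<lambda>y. case (x, y) of (x, y) \<Rightarrow> f x * k y)" using k by simp
      show "integrable M (\<lambda>x. LINT y|M. norm (case (x, y) of (x, y) \<Rightarrow> f x * k y))"
        using f by (simp add: abs_mult)
    qed measurable
    show "AE z in M \<Otimes>\<^sub>M M. norm (case_prod W z) \<le> norm (case z of (x, y) \<Rightarrow> f x * k y)"
      by (auto simp: W_def)
  qed measurable
  have split: "(LINT y|M. f x * k y) = f x * prim k x + (LINT y|M. W x y)" for x
  proof -
    have i1: "integrable M (\<lambda>y. f x * (if y < x then k y else 0))"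
      by (intro integrable_mult_right integrable_less k)
    have i2: "integrable M (W x)"
    proof (rule Bochner_Integration.integrable_bound)
      show "integrable M (\<lambda>y. f x * k y)" using k by simp
      show "W x \<in> borel_measurable M" unfolding W_def by measurable
    qed (auto simp: W_def)
    have "(LINT y|M. f x * k y) = (LINT y|M. f x * (if y < x then k y else 0) + W x y)"
    proof (rule integral_cong_AE)
      show "AE y in M. f x * k y = f x * (if y < x then k y else 0) + W x y"
        using AE_M_neq[of x] by eventually_elim (auto simp: W_def)
    qed (use i1 i2 k in auto)
    then show ?thesis using i1 i2 by (simp add: prim_def)
  qed
  have "(LINT x|M. f x) * (LINT x|M. k x) = (LINT x|M. LINT y|M. f x * k y)" by simp
  also have "\<dots> = (LINT x|M. f x * prim k x) + (LINT x|M. LINT y|M. W x y)"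
    unfolding split using integrable_times_prim[OF f k] P.integrable_fst[OF Wint]
    by (simp add: case_prod_beta)
  also have "(LINT x|M. LINT y|M. W x y) = (LINT y|M. LINT x|M. W x y)"
    using P.Fubini_integral[OF Wint] by simp
  also have "\<dots> = (LINT y|M. k y * prim f y)"
  proof (rule Bochner_Integration.integral_cong)
    fix y
    have "(LINT x|M. W x y) = (LINT x|M. k y * (if x < y then f x else 0))"
      by (intro Bochner_Integration.integral_cong) (auto simp: W_def)
    then show "(LINT x|M. W x y) = k y * prim f y" by (simp add: prim_def)
  qed simp
  finally show ?thesis using integrable_times_prim[OF f k] integrable_times_prim[OF k f] by simp
qed

text \<open>Cutting both functions off at \<open>s\<close> reduces this to the identity over the
  full period, since below \<open>s\<close> the primitives of the cut-off functions are
  unchanged.\<close>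

lemma prim_mult_prim:
  assumes f: "integrable M f" and k: "integrable M k"
  shows "prim f s * prim k s = prim (\<lambda>x. f x * prim k x + k x * prim f x) s"
proof -
  have *: "prim (\<lambda>x. if x < s then h x else 0) x = prim h x" if "x < s" for x h
    using that by (intro prim_cong) auto
  have "prim f s * prim k s = (LINT x|M. (if x < s then f x else 0) * prim (\<lambda>x. if x < s then k x else 0) x
      + (if x < s then k x else 0) * prim (\<lambda>x. if x < s then f x else 0) x)"
    using integral_mult_integral[OF integrable_less[OF f, of s] integrable_less[OF k, of s]]
    by (simp add: prim_def)
  also have "\<dots> = prim (\<lambda>x. f x * prim k x + k x * prim f x) s"
    unfolding prim_def[of _ s] by (intro Bochner_Integration.integral_cong) (auto simp: *)
  finally show ?thesis .
qed

section \<open>Absolutely continuous functions and smooth test functions\<close>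

text \<open>Absolute continuity on the circle with square-integrable derivative \<open>g\<close>,
  written as the integral formula that is actually used. The vanishing mean of \<open>g\<close>
  makes \<open>u\<close> continuous across the seam between \<open>L\<close> and \<open>0\<close>.
  The formula is confined to one period because \<open>prim g\<close> is not periodic.\<close>

definition abs_cont_deriv :: "(real \<Rightarrow> real) \<Rightarrow> (real \<Rightarrow> real) \<Rightarrow> bool" where
  "abs_cont_deriv u g \<longleftrightarrow> periodic_fun_simple u L \<and> g \<in> L2_circle L \<and> (LINT x|M. g x) = 0 \<and>
    (\<forall>s\<in>{0..<L}. u s = u 0 + prim g s)"

lemma abs_cont_deriv_periodic: "abs_cont_deriv u g \<Longrightarrow> periodic_fun_simple u L"
  and abs_cont_deriv_deriv_L2: "abs_cont_deriv u g \<Longrightarrow> g \<in> L2_circle L"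
  and abs_cont_deriv_deriv_mean: "abs_cont_deriv u g \<Longrightarrow> (LINT x|M. g x) = 0"
  and abs_cont_deriv_eq: "abs_cont_deriv u g \<Longrightarrow> s \<in> {0..<L} \<Longrightarrow> u s = u 0 + prim g s"
  unfolding abs_cont_deriv_def by blast+

lemma abs_cont_deriv_square_integrable: "abs_cont_deriv u g \<Longrightarrow> square_integrable M g"
  using abs_cont_deriv_deriv_L2[of u g] by (simp add: L2_circle_iff)

lemma abs_cont_deriv_integrable: "abs_cont_deriv u g \<Longrightarrow> integrable M g"
  by (intro square_integrable_integrable abs_cont_deriv_square_integrable)

lemma abs_cont_deriv_wrap: "abs_cont_deriv u g \<Longrightarrow> u s = u 0 + prim g (wrap s)"
  using abs_cont_deriv_eq[OF _ wrap_in, of u g s] periodic_eq_wrap[OF abs_cont_deriv_periodic, of u g s]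
    by simp

lemma abs_cont_deriv_measurable: "abs_cont_deriv u g \<Longrightarrow> u \<in> borel_measurable borel"
proof -
  assume u: "abs_cont_deriv u g"
  note [measurable] = prim_measurable[OF abs_cont_deriv_integrable[OF u]]
  have "(\<lambda>s. u 0 + prim g (wrap s)) \<in> borel_measurable borel" by measurable
  also have "(\<lambda>s. u 0 + prim g (wrap s)) = u" by (rule ext) (rule abs_cont_deriv_wrap[OF u, symmetric])
  finally show ?thesis .
qed

lemma borel_imp_M: "u \<in> borel_measurable borel \<Longrightarrow> u \<in> borel_measurable M"
  by (rule measurable_compose[OF lebesgue_on_ident_measurable])

lemma borel_imp_lebesgue: "u \<in> borel_measurable borel \<Longrightarrow> u \<in> borel_measurable lebesgue"
  for u :: "real \<Rightarrow> real"
  by (rule measurable_completion) simp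

lemma abs_cont_deriv_osc: "abs_cont_deriv u g \<Longrightarrow> \<bar>u s - u t\<bar> \<le> (LINT x|M. \<bar>g x\<bar>)"
  using abs_cont_deriv_wrap[of u g s] abs_cont_deriv_wrap[of u g t]
    prim_diff_bound[OF abs_cont_deriv_integrable, of u g "wrap s" "wrap t"] by simp

lemma abs_cont_deriv_osc_square: "abs_cont_deriv u g \<Longrightarrow> (u s - u t)\<^sup>2 \<le> L * (LINT x|M. (g x)\<^sup>2)"
  using power_mono[OF abs_cont_deriv_osc[of u g s t], of 2]
    integral_square_bound[OF abs_cont_deriv_square_integrable, of u g] measure_M by simp

lemma abs_cont_deriv_bounded: "abs_cont_deriv u g \<Longrightarrow> \<bar>u s\<bar> \<le> \<bar>u 0\<bar> + (LINT x|M. \<bar>g x\<bar>)"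
  using abs_cont_deriv_osc[of u g s 0] by linarith

lemma abs_cont_deriv_L2: "abs_cont_deriv u g \<Longrightarrow> u \<in> L2_circle L"
  unfolding L2_circle_iff
  by (intro conjI abs_cont_deriv_periodic borel_imp_lebesgue abs_cont_deriv_measurable
      square_integrable_bounded[OF borel_imp_M abs_cont_deriv_bounded])

lemma L2_circle_comb:
  assumes "g \<in> L2_circle L" "h \<in> L2_circle L"
  shows "(\<lambda>s. p * g s + q * h s) \<in> L2_circle L"
proof -
  have "periodic_fun_simple (\<lambda>s. p * g s + q * h s) L"
  proof
    fix s show "p * g (s + L) + q * h (s + L) = p * g s + q * h s"
      using assms by (simp add: L2_circle_iff periodic_fun_simple.plus_period)
  qed
  moreover note [measurable] = assms[unfolded L2_circle_iff, THEN conjunct2, THEN conjunct1]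
  have "(\<lambda>s. p * g s + q * h s) \<in> borel_measurable lebesgue" by measurable
  ultimately show ?thesis using assms by (simp add: L2_circle_iff square_integrable_comb)
qed

lemma abs_cont_deriv_comb:
  assumes u: "abs_cont_deriv u g" and v: "abs_cont_deriv v h"
  shows "abs_cont_deriv (\<lambda>s. p * u s + q * v s) (\<lambda>s. p * g s + q * h s)"
proof -
  note int = abs_cont_deriv_integrable[OF u] abs_cont_deriv_integrable[OF v]
  have per: "periodic_fun_simple (\<lambda>s. p * u s + q * v s) L"
  proof
    fix s show "p * u (s + L) + q * v (s + L) = p * u s + q * v s"
      using abs_cont_deriv_periodic[OF u] abs_cont_deriv_periodic[OF v]
        by (simp add: periodic_fun_simple.plus_period)
  qed
  have eq: "p * u s + q * v s = p * u 0 + q * v 0 + prim (\<lambda>s. p * g s + q * h s) s"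
    if "s \<in> {0..<L}" for s
    using prim_comb[OF int, of p q s] abs_cont_deriv_eq[OF u that] abs_cont_deriv_eq[OF v that]
    by (simp add: algebra_simps)
  have mean: "(LINT s|M. p * g s + q * h s) = 0"
    using abs_cont_deriv_deriv_mean[OF u] abs_cont_deriv_deriv_mean[OF v] int by simp
  show ?thesis unfolding abs_cont_deriv_def
    by (intro conjI ballI per eq mean L2_circle_comb abs_cont_deriv_deriv_L2[OF u] abs_cont_deriv_deriv_L2[OF v])
qed

lemma abs_cont_deriv_const: "abs_cont_deriv (\<lambda>s. k) (\<lambda>s. 0)"
proof -
  have "prim (\<lambda>s. 0) s = 0" for s using prim_comb[of "\<lambda>_. 0" "\<lambda>_. 0" 0 0 s] by simp
  then show ?thesis
    by (auto simp: abs_cont_deriv_def L2_circle_iff square_integrable_def periodic_fun_simple_def)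
qed

text \<open>The product rule, and the reason why \<open>c\<close> can be paired with
  \<open>u * v\<close>: in dimension one the functions are bounded, so the derivative of the product
  stays square-integrable. Its mean vanishes by the product formula for primitives at the end point
  \<open>L\<close>.\<close>

lemma abs_cont_deriv_mult:
  assumes u: "abs_cont_deriv u g" and v: "abs_cont_deriv v h"
  shows "abs_cont_deriv (\<lambda>s. u s * v s) (\<lambda>s. u s * h s + v s * g s)"
proof -
  note int = abs_cont_deriv_integrable[OF u] abs_cont_deriv_integrable[OF v]
  have pr: "prim (\<lambda>x. u x * h x + v x * g x) s
      = u 0 * prim h s + v 0 * prim g s + prim g s * prim h s" for s
  proof -
    have "prim (\<lambda>x. u x * h x + v x * g x) s
      = prim (\<lambda>x. 1 * (u 0 * h x + v 0 * g x) + 1 * (g x * prim h x + h x * prim g x)) s"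
    proof (rule prim_cong)
      fix x assume "x \<in> {0..<L}"
      from abs_cont_deriv_eq[OF u this] abs_cont_deriv_eq[OF v this]
      show "u x * h x + v x * g x
          = 1 * (u 0 * h x + v 0 * g x) + 1 * (g x * prim h x + h x * prim g x)"
        by (simp add: algebra_simps)
    qed
    also have "\<dots> = prim (\<lambda>x. u 0 * h x + v 0 * g x) s + prim (\<lambda>x. g x * prim h x + h x * prim g x) s"
      by (subst prim_comb) (auto intro!: integrable_times_prim int integrable_mult_right)
    finally show ?thesis using prim_comb[OF int(2,1)] prim_mult_prim[OF int] by simp
  qed
  have sq: "square_integrable M (\<lambda>s. u s * h s + v s * g s)"
    using square_integrable_times_bounded[OF abs_cont_deriv_square_integrable[OF v]
        borel_imp_M[OF abs_cont_deriv_measurable[OF u]] abs_cont_deriv_bounded[OF u]]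
      square_integrable_times_bounded[OF abs_cont_deriv_square_integrable[OF u]
        borel_imp_M[OF abs_cont_deriv_measurable[OF v]] abs_cont_deriv_bounded[OF v]]
    by (rule square_integrable_add)
  have per: "periodic_fun_simple (\<lambda>s. u s * v s) L" "periodic_fun_simple (\<lambda>s. u s * h s + v s * g s) L"
    using abs_cont_deriv_L2[OF u] abs_cont_deriv_L2[OF v] abs_cont_deriv_deriv_L2[OF u]
      abs_cont_deriv_deriv_L2[OF v]
    by (simp_all add: L2_circle_iff periodic_fun_simple_def)
  note [measurable] = abs_cont_deriv_L2[OF u, unfolded L2_circle_iff, THEN conjunct2, THEN conjunct1]
    abs_cont_deriv_L2[OF v, unfolded L2_circle_iff, THEN conjunct2, THEN conjunct1]
    abs_cont_deriv_deriv_L2[OF u, unfolded L2_circle_iff, THEN conjunct2, THEN conjunct1]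
    abs_cont_deriv_deriv_L2[OF v, unfolded L2_circle_iff, THEN conjunct2, THEN conjunct1]
  have meas: "(\<lambda>s. u s * h s + v s * g s) \<in> borel_measurable lebesgue" by measurable
  have mean: "(LINT x|M. u x * h x + v x * g x) = 0"
    using pr[of L] abs_cont_deriv_deriv_mean[OF u] abs_cont_deriv_deriv_mean[OF v] by (simp add: prim_L)
  have eq: "u s * v s = u 0 * v 0 + prim (\<lambda>x. u x * h x + v x * g x) s" if "s \<in> {0..<L}" for s
    using abs_cont_deriv_eq[OF u that] abs_cont_deriv_eq[OF v that] pr[of s] by (simp add: algebra_simps)
  show ?thesis unfolding abs_cont_deriv_def L2_circle_iff by (intro conjI ballI per meas sq mean eq)
qed

section \<open>Smooth periodic functions and trigonometric polynomials\<close>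

lemma smooth_periodic: "\<phi> \<in> smooth_circle L \<Longrightarrow> periodic_fun_simple \<phi> L"
  by (simp add: smooth_circle_def)

lemma smooth_DERIV: "\<phi> \<in> smooth_circle L \<Longrightarrow> (\<phi> has_real_derivative deriv \<phi> s) (at s)"
proof -
  assume "\<phi> \<in> smooth_circle L"
  then have "(deriv ^^ 0) \<phi> field_differentiable (at s)" unfolding smooth_circle_def by blast
  then show ?thesis unfolding DERIV_deriv_iff_field_differentiable by simp
qed

lemma smooth_continuous: "\<phi> \<in> smooth_circle L \<Longrightarrow> continuous_on UNIV \<phi>"
  by (meson DERIV_isCont smooth_DERIV continuous_at_imp_continuous_on)

lemma smooth_deriv:
  assumes \<phi>: "\<phi> \<in> smooth_circle L" shows "deriv \<phi> \<in> smooth_circle L"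
proof -
  have "(deriv ^^ n) (deriv \<phi>) field_differentiable (at s)" for n s
  proof -
    have "(deriv ^^ Suc n) \<phi> field_differentiable (at s)" using \<phi> unfolding smooth_circle_def by blast
    then show ?thesis unfolding funpow_Suc_right comp_def .
  qed
  moreover have "periodic_fun_simple (deriv \<phi>) L"
  proof
    fix s
    have "(\<lambda>x. \<phi> (x + L)) = \<phi>"
      using smooth_periodic[OF \<phi>] by (simp add: periodic_fun_simple_def)
    then have "(\<phi> has_real_derivative deriv \<phi> (s + L)) (at s)"
      using smooth_DERIV[OF \<phi>, of "s + L"] DERIV_shift[of \<phi> _ s L] by simp
    then show "deriv \<phi> (s + L) = deriv \<phi> s" using DERIV_imp_deriv by metis
  qed
  ultimately show ?thesis by (simp add: smooth_circle_def)
qed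

lemma prim_FTC:
  assumes F: "\<And>x. (F has_real_derivative f x) (at x)" and f: "continuous_on UNIV f"
    and s: "0 \<le> s" "s \<le> L"
  shows "prim f s = F s - F 0"
proof -
  have [measurable]: "f \<in> borel_measurable borel" using f by (rule borel_measurable_continuous_onI)
  have "prim f s = (LINT x|lebesgue. indicator {0..<L} x *\<^sub>R (if x < s then f x else 0))"
    unfolding prim_def by (rule integral_restrict_space) simp
  also have "\<dots> = (LINT x|lborel. indicator {0..<L} x *\<^sub>R (if x < s then f x else 0))"
    by (rule integral_completion) measurable
  also have "\<dots> = (LINT x|lborel. f x * indicator {0..s} x)"
  proof (rule integral_cong_AE)
    show "AE x in lborel. indicator {0..<L} x *\<^sub>R (if x < s then f x else 0) = f x * indicator {0..s} x"
      using AE_lborel_singleton[of s]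
        by eventually_elim (use s in \<open>auto simp: indicator_def\<close>)
  qed measurable
  also have "\<dots> = F s - F 0"
    using f F by (intro integral_FTC_Icc_real s) (auto simp: continuous_on_eq_continuous_at)
  finally show ?thesis .
qed

lemma continuous_periodic_L2:
  assumes "periodic_fun_simple f L" "continuous_on UNIV f"
  shows "f \<in> L2_circle L"
proof -
  have f: "f \<in> borel_measurable borel" using assms(2) by (rule borel_measurable_continuous_onI)
  have "bounded (f ` {0..L})"
    using assms(2) by (intro compact_imp_bounded compact_continuous_image) (auto intro: continuous_on_subset)
  then obtain C where "\<And>x. x \<in> {0..L} \<Longrightarrow> \<bar>f x\<bar> \<le> C"
    unfolding bounded_iff by (metis imageI real_norm_def)
  then have "square_integrable M f"
    by (intro square_integrable_bounded[OF borel_imp_M[OF f], of C]) auto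
  then show ?thesis using assms(1) borel_imp_lebesgue[OF f] by (simp add: L2_circle_iff)
qed

lemma smooth_abs_cont_deriv:
  assumes \<phi>: "\<phi> \<in> smooth_circle L" shows "abs_cont_deriv \<phi> (deriv \<phi>)"
proof -
  note d = smooth_deriv[OF \<phi>]
  have eq: "prim (deriv \<phi>) s = \<phi> s - \<phi> 0" if "0 \<le> s" "s \<le> L" for s
    using smooth_DERIV[OF \<phi>] smooth_continuous[OF d] that by (rule prim_FTC)
  have "\<phi> L = \<phi> 0"
    using periodic_fun_simple.plus_period[OF smooth_periodic[OF \<phi>], of 0] by simp
  then have "(LINT x|M. deriv \<phi> x) = 0" using eq[of L] L_pos by (simp add: prim_L)
  then show ?thesis
    using eq smooth_periodic[OF \<phi>]
      continuous_periodic_L2[OF smooth_periodic[OF d] smooth_continuous[OF d]]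
    by (simp add: abs_cont_deriv_def)
qed

lemma L2_circle_mult_integrable:
  "g \<in> L2_circle L \<Longrightarrow> h \<in> L2_circle L \<Longrightarrow> integrable M (\<lambda>x. g x * h x)"
  by (simp add: L2_circle_iff square_integrable_mult)

text \<open>By the product rule \<open>u * \<phi>\<close> is again absolutely continuous on the
  circle, and the vanishing mean of its derivative is the integration by parts formula.\<close>

lemma abs_cont_deriv_imp_weak_deriv:
  assumes u: "abs_cont_deriv u g" shows "has_weak_deriv L u g"
  unfolding has_weak_deriv_def circle_integral_eq
proof (intro conjI ballI abs_cont_deriv_L2[OF u] abs_cont_deriv_deriv_L2[OF u])
  fix \<phi> assume \<phi>: "\<phi> \<in> smooth_circle L"
  note int = L2_circle_mult_integrable[OF abs_cont_deriv_L2[OF u] abs_cont_deriv_deriv_L2[OF smooth_abs_cont_deriv[OF \<phi>]]]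
    L2_circle_mult_integrable[OF abs_cont_deriv_deriv_L2[OF u] abs_cont_deriv_L2[OF smooth_abs_cont_deriv[OF \<phi>]]]
  have "(LINT s|M. u s * deriv \<phi> s + \<phi> s * g s) = 0"
    by (rule abs_cont_deriv_deriv_mean[OF abs_cont_deriv_mult[OF u smooth_abs_cont_deriv[OF \<phi>]]])
  then show "(LINT s|M. u s * deriv \<phi> s) = - (LINT s|M. g s * \<phi> s)"
    using int by (simp add: mult.commute[of "\<phi> _"])
qed

text \<open>Trigonometric polynomials are encoded as real polynomials in the point
  \<open>cis (\<omega> * s)\<close> of the plane. Differentiating this point multiplies it by
  \<open>\<i> * \<omega>\<close>, a linear map, so the class is closed under derivatives and all its
  members are smooth.\<close>

lemma trig_polynomial_deriv:
  fixes \<omega> :: real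
  assumes "real_polynomial_function p"
  shows "\<exists>q. real_polynomial_function q \<and>
    (\<forall>s. ((\<lambda>s. p (cis (\<omega> * s))) has_real_derivative q (cis (\<omega> * s))) (at s))"
  using assms
proof induction
  case (linear f)
  then have f: "bounded_linear f" .
  have "bounded_linear (\<lambda>z. f (of_real \<omega> * \<i> * z))"
    by (intro bounded_linear_compose[OF f] bounded_linear_mult_right)
  moreover have "((\<lambda>s. f (cis (\<omega> * s))) has_real_derivative f (of_real \<omega> * \<i> * cis (\<omega> * s))) (at s)" for s
  proof -
    have "((\<lambda>s. cis (\<omega> * s)) has_vector_derivative (of_real \<omega> * \<i> * cis (\<omega> * s))) (at s)"
    proof -
      have "((\<lambda>z. exp (\<i> * (of_real \<omega> * z))) has_field_derivative
          (of_real \<omega> * \<i> * exp (\<i> * (of_real \<omega> * of_real s)))) (at (of_real s))"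
        by (auto intro!: derivative_eq_intros)
      from has_vector_derivative_real_field[OF this] show ?thesis by (simp add: cis_conv_exp)
    qed
    from bounded_linear.has_vector_derivative[OF f this] show ?thesis
      by (simp add: has_real_derivative_iff_has_vector_derivative)
  qed
  ultimately show ?case by blast
next
  case (const c)
  then show ?case by (intro exI[of _ "\<lambda>_. 0"]) auto
next
  case (add f g)
  then obtain p q where "real_polynomial_function p" "real_polynomial_function q"
    "\<And>s. ((\<lambda>s. f (cis (\<omega> * s))) has_real_derivative p (cis (\<omega> * s))) (at s)"
    "\<And>s. ((\<lambda>s. g (cis (\<omega> * s))) has_real_derivative q (cis (\<omega> * s))) (at s)" by blast
  then show ?case
    by (intro exI[of _ "\<lambda>z. p z + q z"]) (auto intro!: DERIV_add)
next
  case (mult f g)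
  then obtain p q where "real_polynomial_function p" "real_polynomial_function q"
    "\<And>s. ((\<lambda>s. f (cis (\<omega> * s))) has_real_derivative p (cis (\<omega> * s))) (at s)"
    "\<And>s. ((\<lambda>s. g (cis (\<omega> * s))) has_real_derivative q (cis (\<omega> * s))) (at s)" by blast
  with mult.hyps show ?case
    by (intro exI[of _ "\<lambda>z. p z * g z + q z * f z"]) (auto intro!: DERIV_mult)
qed

lemma trig_polynomial_smooth:
  assumes "real_polynomial_function p"
  shows "(\<lambda>s. p (cis (2 * pi / L * s))) \<in> smooth_circle L"
proof -
  have "\<exists>q. real_polynomial_function q \<and>
      (deriv ^^ n) (\<lambda>s. p (cis (2 * pi / L * s))) = (\<lambda>s. q (cis (2 * pi / L * s)))" for n
  proof (induction n)
    case (Suc n)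
    then obtain q where q: "real_polynomial_function q"
      "(deriv ^^ n) (\<lambda>s. p (cis (2 * pi / L * s))) = (\<lambda>s. q (cis (2 * pi / L * s)))" by blast
    from trig_polynomial_deriv[OF q(1), of "2 * pi / L"] obtain r where "real_polynomial_function r"
      "\<And>s. ((\<lambda>s. q (cis (2 * pi / L * s))) has_real_derivative r (cis (2 * pi / L * s))) (at s)" by blast
    then have "deriv (\<lambda>s. q (cis (2 * pi / L * s))) = (\<lambda>s. r (cis (2 * pi / L * s)))"
      by (intro ext DERIV_imp_deriv)
    with q(2) \<open>real_polynomial_function r\<close> show ?case by auto
  qed (use assms in auto)
  then have "(deriv ^^ n) (\<lambda>s. p (cis (2 * pi / L * s))) field_differentiable (at s)" for n s
    using trig_polynomial_deriv[of _ "2 * pi / L"] unfolding field_differentiable_def by metis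
  moreover have "periodic_fun_simple (\<lambda>s. p (cis (2 * pi / L * s))) L"
  proof
    fix s
    have "cis (2 * pi / L * (s + L)) = cis (2 * pi / L * s + 2 * pi)"
      using L_pos by (simp add: field_simps)
    then show "p (cis (2 * pi / L * (s + L))) = p (cis (2 * pi / L * s))"
      by (simp flip: cis_mult)
  qed
  ultimately show ?thesis by (simp add: smooth_circle_def)
qed

section \<open>Absolutely continuous representatives of Sobolev functions\<close>

lemma cis_winding_measurable: "(\<lambda>s. cis (2 * pi / L * s)) \<in> borel_measurable M"
  by (intro borel_imp_M borel_measurable_continuous_onI continuous_intros)

text \<open>Stone--Weierstrass on the unit circle of the complex plane supplies enough trigonometric
  polynomials to test against every continuous function of \<open>cis (2 * pi / L * s)\<close>.\<close>

lemma orthogonal_continuous: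
  assumes w: "integrable M w" and orth: "\<And>\<phi>. \<phi> \<in> smooth_circle L \<Longrightarrow> (LINT s|M. w s * \<phi> s) = 0"
    and F: "continuous_on UNIV (F :: complex \<Rightarrow> real)"
  shows "(LINT s|M. w s * F (cis (2 * pi / L * s))) = 0"
proof -
  define I where "I = (LINT s|M. w s * F (cis (2 * pi / L * s)))"
  define A where "A = (LINT s|M. \<bar>w s\<bar>)"
  note [measurable] = borel_measurable_integrable[OF w]
  have int: "integrable M (\<lambda>s. w s * G (cis (2 * pi / L * s)))"
    if G: "continuous_on UNIV G" for G :: "complex \<Rightarrow> real"
  proof -
    have "bounded (G ` sphere 0 1)"
      using G by (intro compact_imp_bounded compact_continuous_image) (auto intro: continuous_on_subset)
    then obtain C where C: "\<And>z. z \<in> sphere 0 1 \<Longrightarrow> \<bar>G z\<bar> \<le> C"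
      unfolding bounded_iff by (metis imageI real_norm_def)
    show ?thesis
    proof (rule Bochner_Integration.integrable_bound)
      show "integrable M (\<lambda>s. C * w s)" using w by simp
      have "(\<lambda>s. G (cis (2 * pi / L * s))) \<in> borel_measurable M"
        by (rule measurable_compose[OF cis_winding_measurable borel_measurable_continuous_onI[OF G]])
      then show "(\<lambda>s. w s * G (cis (2 * pi / L * s))) \<in> borel_measurable M" by measurable
      have "\<bar>w s * G (cis (2 * pi / L * s))\<bar> \<le> \<bar>C * w s\<bar>" for s
        using mult_right_mono[OF C[of "cis (2 * pi / L * s)"], of "\<bar>w s\<bar>"]
        unfolding abs_mult by (simp add: mult.commute) (smt (verit) abs_ge_self mult_right_mono abs_ge_zero)
      then show "AE s in M. norm (w s * G (cis (2 * pi / L * s))) \<le> norm (C * w s)" by simp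
    qed
  qed
  have "\<bar>I\<bar> \<le> e * A" if e: "e > 0" for e
  proof -
    obtain p where p: "real_polynomial_function p"
      and pF: "\<And>z. z \<in> sphere 0 1 \<Longrightarrow> \<bar>F z - p z\<bar> < e"
      using Stone_Weierstrass_real_polynomial_function[of "sphere (0::complex) 1" F e] e F
      by (metis compact_sphere continuous_on_subset top_greatest)
    have pc: "continuous_on UNIV p"
      using p by (simp add: continuous_on_polymonial_function real_polynomial_function_eq)
    have "I = I - (LINT s|M. w s * p (cis (2 * pi / L * s)))"
      using orth[OF trig_polynomial_smooth[OF p]] by simp
    also have "\<dots> = (LINT s|M. w s * F (cis (2 * pi / L * s)) - w s * p (cis (2 * pi / L * s)))"
      unfolding I_def by (intro Bochner_Integration.integral_diff[symmetric] int F pc)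
    finally have "\<bar>I\<bar> = \<bar>LINT s|M. w s * F (cis (2 * pi / L * s)) - w s * p (cis (2 * pi / L * s))\<bar>"
      by (rule arg_cong)
    also have "\<dots> \<le> (LINT s|M. \<bar>w s * F (cis (2 * pi / L * s)) - w s * p (cis (2 * pi / L * s))\<bar>)"
      by (rule integral_abs_bound)
    also have "\<dots> \<le> (LINT s|M. e * \<bar>w s\<bar>)"
    proof (rule integral_mono)
      fix s
      show "\<bar>w s * F (cis (2 * pi / L * s)) - w s * p (cis (2 * pi / L * s))\<bar> \<le> e * \<bar>w s\<bar>"
        using mult_left_mono[OF less_imp_le[OF pF[of "cis (2 * pi / L * s)"]], of "\<bar>w s\<bar>"]
        by (simp flip: right_diff_distrib add: abs_mult mult.commute)
    qed (use w int[OF F] int[OF pc] in auto)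
    finally show ?thesis by (simp add: A_def)
  qed
  have "\<bar>I\<bar> \<le> 0"
  proof (rule field_le_epsilon)
    fix e :: real assume "e > 0"
    moreover have "A \<ge> 0" unfolding A_def by simp
    \<comment> \<open>Dividing by \<open>A + 1\<close> instead of \<open>A\<close> covers the case
      that \<open>w\<close> vanishes almost everywhere.\<close>
    ultimately have "\<bar>I\<bar> \<le> e / (A + 1) * A" by (intro \<open>\<And>e. e > 0 \<Longrightarrow> \<bar>I\<bar> \<le> e * A\<close>) simp
    also have "\<dots> \<le> e" using \<open>e > 0\<close> \<open>A \<ge> 0\<close> by (simp add: field_simps)
    finally show "\<bar>I\<bar> \<le> 0 + e" by simp
  qed
  then show ?thesis by (simp add: I_def)
qed

text \<open>On the half-open period the angle lies in \<open>{0..<2 * pi}\<close>, where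
  \<open>Arg2pi\<close> recovers it. Injectivity is what keeps the image of a point outside a set
  away from the image of that set.\<close>

lemma cis_winding_inj: "inj_on (\<lambda>s. cis (2 * pi / L * s)) {0..<L}"
proof (rule inj_onI)
  fix s t assume s: "s \<in> {0..<L}" and t: "t \<in> {0..<L}"
    and eq: "cis (2 * pi / L * s) = cis (2 * pi / L * t)"
  have "2 * pi / L * x \<in> {0..<2 * pi}" if "x \<in> {0..<L}" for x
    using that L_pos by (auto simp: field_simps)
  then have "Arg2pi (cis (2 * pi / L * x)) = 2 * pi / L * x" if "x \<in> {0..<L}" for x
    using that by (intro Arg2pi_unique[of 1]) (auto simp: cis_conv_exp)
  then have "2 * pi / L * s = 2 * pi / L * t" using s t eq by metis
  then show "s = t" using L_pos by simp
qed

text \<open>The indicator of \<open>K\<close> is the pointwise limit of tent functions on the unit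
  circle: \<open>F n\<close> is \<open>1\<close> on the image of \<open>K\<close> and falls to
  \<open>0\<close> within distance \<open>1 / n\<close>. They take values in \<open>[0,1]\<close>,
  so dominated convergence applies with bound \<open>\<bar>w s\<bar>\<close>.\<close>

lemma orthogonal_compact:
  assumes w: "integrable M w" and orth: "\<And>\<phi>. \<phi> \<in> smooth_circle L \<Longrightarrow> (LINT s|M. w s * \<phi> s) = 0"
    and K: "compact K" "K \<subseteq> {0..<L}"
  shows "(LINT s|M. w s * indicator K s) = 0"
\<comment> \<open>\<open>infdist\<close> to the empty set is \<open>0\<close> by convention, so for
  empty \<open>K\<close> the tent functions would be constantly \<open>1\<close>.\<close>
proof (cases "K = {}")
  case False
  define E where "E s = cis (2 * pi / L * s)" for s
  have E: "continuous_on UNIV E" unfolding E_def by (intro continuous_intros)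
  have cl: "closed (E ` K)"
    using K by (intro compact_imp_closed compact_continuous_image) (auto intro: continuous_on_subset[OF E])
  define F where "F n z = max 0 (1 - real n * infdist z (E ` K))" for n z
  have F: "continuous_on UNIV (F n)" for n unfolding F_def by (intro continuous_intros)
  have Fm: "(\<lambda>s. F n (E s)) \<in> borel_measurable M" for n
    unfolding E_def by (rule measurable_compose[OF cis_winding_measurable borel_measurable_continuous_onI[OF F]])
  note [measurable] = Fm borel_measurable_integrable[OF w]
  have "(\<lambda>n. LINT s|M. w s * F n (E s)) \<longlonglongrightarrow> (LINT s|M. w s * indicator K s)"
  proof (rule integral_dominated_convergence[where w="\<lambda>s. \<bar>w s\<bar>"])
    have "K \<in> sets lebesgue" using K(1) by (simp add: compact_imp_closed)
    then have "indicator K \<in> borel_measurable M"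
      by (intro measurable_restrict_space1 borel_measurable_indicator)
    then show "(\<lambda>s. w s * indicator K s) \<in> borel_measurable M" by measurable
    have "\<bar>F n z\<bar> \<le> 1" for n z using infdist_nonneg[of z "E ` K"] by (auto simp: F_def)
    then show "AE s in M. norm (w s * F n (E s)) \<le> \<bar>w s\<bar>" for n
      by (auto simp: abs_mult intro!: mult_left_le)
    have "(\<lambda>n. F n (E s)) \<longlonglongrightarrow> indicator K s" if s: "s \<in> {0..<L}" for s
    proof (cases "s \<in> K")
      case True
      then have "infdist (E s) (E ` K) = 0" by simp
      then show ?thesis using True by (simp add: F_def)
    next
      case s': False
      have "E s \<notin> E ` K"
      proof
        assume "E s \<in> E ` K"
        then obtain t where "t \<in> K" "E s = E t" by blast
        with cis_winding_inj s K(2) s' show False unfolding inj_on_def E_def by blast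
      qed
      then have d: "infdist (E s) (E ` K) > 0"
        using cl False by (intro infdist_pos_not_in_closed) auto
      obtain N :: nat where N: "1 / infdist (E s) (E ` K) < real N" using reals_Archimedean2 by blast
      have "F n (E s) = 0" if "n \<ge> N" for n
      proof -
        have "1 / infdist (E s) (E ` K) < real n" using N that by linarith
        then have "1 < real n * infdist (E s) (E ` K)" using d by (simp add: divide_less_eq)
        then show ?thesis by (simp add: F_def)
      qed
      then have "\<forall>\<^sub>F n in sequentially. F n (E s) = 0" unfolding eventually_sequentially by blast
      then show ?thesis using s' by (simp add: tendsto_eventually)
    qed
    then show "AE s in M. (\<lambda>n. w s * F n (E s)) \<longlonglongrightarrow> w s * indicator K s"
      by (intro AE_I2 tendsto_intros) auto
  qed (use w in auto)
  moreover have "(LINT s|M. w s * F n (E s)) = 0" for n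
    unfolding E_def by (rule orthogonal_continuous[OF w orth F])
  ultimately show ?thesis by (simp add: LIMSEQ_const_iff)
qed simp

text \<open>Inner regularity: the set where \<open>w\<close> is positive is exhausted, up to measure
  \<open>e\<close>, by a compact \<open>T\<close>. The integral of \<open>w\<close> over
  \<open>T\<close> is zero while \<open>w\<close> is positive there, so \<open>T\<close> is a null
  set.\<close>

lemma orthogonal_le_0:
  assumes w: "integrable M w" and orth: "\<And>\<phi>. \<phi> \<in> smooth_circle L \<Longrightarrow> (LINT s|M. w s * \<phi> s) = 0"
  shows "AE s in M. w s \<le> 0"
proof -
  define P where "P = {s\<in>space M. 0 < w s}"
  note [measurable] = borel_measurable_integrable[OF w]
  have "P \<in> sets M" unfolding P_def by measurable
  then have P: "P \<in> sets lebesgue" "P \<subseteq> {0..<L}"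
    using sets_restrict_space_iff[of "{0..<L}" lebesgue P] by auto
  have "emeasure lebesgue P \<le> 0 + ennreal e" if e: "e > 0" for e
  proof -
    obtain T where T: "closed T" "T \<subseteq> P" "emeasure lebesgue (P - T) < ennreal e"
      using sets_lebesgue_inner_closed[OF P(1) e] by metis
    have "bounded T" using bounded_subset[of "{0..<L}" T] T(2) P(2) by (auto simp: bounded_closed_interval)
    then have "compact T" using T(1) by (simp add: compact_eq_bounded_closed)
    have TL: "T \<in> sets lebesgue" using T(1) by simp
    then have TM: "T \<in> sets M"
      using T(2) P(2) sets_restrict_space_iff[of "{0..<L}" lebesgue T] by auto
    have "integrable M (\<lambda>s. w s * indicator T s)"
      using w TM by (intro integrable_real_mult_indicator)
    moreover have "AE s in M. 0 \<le> w s * indicator T s"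
      using T(2) by (auto simp: P_def indicator_def intro!: AE_I2)
    moreover have "(LINT s|M. w s * indicator T s) = 0"
      using orthogonal_compact[OF w orth \<open>compact T\<close>] T(2) P(2) by blast
    ultimately have "AE s in M. w s * indicator T s = 0"
      by (simp add: integral_nonneg_eq_0_iff_AE)
    then have "AE s in M. s \<notin> T"
      by eventually_elim (use T(2) in \<open>auto simp: P_def indicator_def split: if_splits\<close>)
    then have "AE s in lebesgue. s \<notin> T"
      unfolding AE_M_iff by eventually_elim (use T(2) P(2) in auto)
    then have "emeasure lebesgue T = 0" using AE_iff_null_sets[OF TL] by auto
    moreover have "emeasure lebesgue P \<le> emeasure lebesgue T + emeasure lebesgue (P - T)"
      using emeasure_subadditive[of T lebesgue "P - T"] TL P(1) T(2)
      by (metis Un_Diff_cancel Un_absorb1 sets.Diff)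
    ultimately show ?thesis using T(3) by simp
  qed
  then have "emeasure lebesgue P \<le> 0" by (rule ennreal_le_epsilon)
  then have "P \<in> null_sets lebesgue" using P(1) by auto
  then have "AE s in lebesgue. s \<notin> P" by (rule AE_not_in)
  then show ?thesis unfolding AE_M_iff by eventually_elim (auto simp: P_def)
qed

lemma orthogonal_eq_0:
  assumes w: "integrable M w" and orth: "\<And>\<phi>. \<phi> \<in> smooth_circle L \<Longrightarrow> (LINT s|M. w s * \<phi> s) = 0"
  shows "AE s in M. w s = 0"
proof -
  have "AE s in M. w s \<le> 0" by (rule orthogonal_le_0[OF w orth])
  moreover have "AE s in M. - w s \<le> 0" using w orth by (intro orthogonal_le_0) auto
  ultimately show ?thesis by eventually_elim simp
qed

section \<open>Periodic antiderivatives and du Bois-Reymond's lemma\<close>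

lemma smooth_diff_const:
  assumes \<phi>: "\<phi> \<in> smooth_circle L" shows "(\<lambda>s. \<phi> s - k) \<in> smooth_circle L"
proof -
  have "((\<lambda>s. \<phi> s - k) has_real_derivative deriv \<phi> s) (at s)" for s
    using DERIV_diff[OF smooth_DERIV[OF \<phi>, of s] DERIV_const[of k]] by simp
  then have d: "deriv (\<lambda>s. \<phi> s - k) = deriv \<phi>" and d0: "(\<lambda>s. \<phi> s - k) field_differentiable (at s)" for s
    by (auto intro!: DERIV_imp_deriv simp: field_differentiable_def)
  have "(deriv ^^ n) (\<lambda>s. \<phi> s - k) field_differentiable (at s)" for n s
  proof (cases n)
    case (Suc m)
    have "(deriv ^^ m) (deriv \<phi>) field_differentiable (at s)"
      using smooth_deriv[OF \<phi>] unfolding smooth_circle_def by blast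
    then show ?thesis unfolding Suc funpow_Suc_right comp_def d .
  qed (use d0 in simp)
  moreover have "periodic_fun_simple (\<lambda>s. \<phi> s - k) L"
    using smooth_periodic[OF \<phi>] by (simp add: periodic_fun_simple_def)
  ultimately show ?thesis by (simp add: smooth_circle_def)
qed

text \<open>The increment of an antiderivative over one period has derivative zero, hence equals the
  integral of \<open>\<psi>\<close> over the period. The vanishing mean therefore makes the
  antiderivative periodic.\<close>

lemma smooth_antiderivative:
  assumes \<psi>: "\<psi> \<in> smooth_circle L" and mean: "(LINT s|M. \<psi> s) = 0"
  shows "\<exists>\<Phi>\<in>smooth_circle L. deriv \<Phi> = \<psi>"
proof -
  have "isCont \<psi> x" for x using smooth_continuous[OF \<psi>] by (simp add: continuous_on_eq_continuous_at)
  then obtain F where "\<And>x. (F has_vector_derivative \<psi> x) (at x)"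
    using einterval_antiderivative[of "-\<infinity>" "\<infinity>" \<psi>] by auto
  then have F: "(F has_real_derivative \<psi> x) (at x)" for x
    by (simp add: has_real_derivative_iff_has_vector_derivative)
  then have d: "deriv F = \<psi>" by (intro ext DERIV_imp_deriv)
  have "periodic_fun_simple F L"
  proof
    fix s
    have "((\<lambda>x. F (x + L) - F x) has_real_derivative 0) (at x)" for x
    proof -
      have "((\<lambda>x. F (x + L)) has_real_derivative \<psi> (x + L)) (at x)"
        using F[of "x + L"] by (simp add: DERIV_shift)
      from DERIV_diff[OF this F[of x]] show ?thesis
        using periodic_fun_simple.plus_period[OF smooth_periodic[OF \<psi>], of x] by simp
    qed
    then have "F (s + L) - F s = F (0 + L) - F 0" using DERIV_isconst_all by blast
    moreover have "F L - F 0 = 0"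
      using prim_FTC[OF F smooth_continuous[OF \<psi>], of L] L_pos mean by (simp add: prim_L)
    ultimately show "F (s + L) = F s" by simp
  qed
  moreover have "(deriv ^^ n) F field_differentiable (at s)" for n s
  proof (cases n)
    case 0
    then show ?thesis using F by (auto simp: field_differentiable_def)
  next
    case (Suc m)
    have "(deriv ^^ m) \<psi> field_differentiable (at s)" using \<psi> unfolding smooth_circle_def by blast
    then show ?thesis unfolding Suc funpow_Suc_right comp_def d .
  qed
  ultimately have "F \<in> smooth_circle L" by (simp add: smooth_circle_def)
  with d show ?thesis by blast
qed

lemma L2_circle_integrable: "g \<in> L2_circle L \<Longrightarrow> integrable M g"
  by (simp add: L2_circle_iff square_integrable_integrable)

lemma smooth_L2: "\<phi> \<in> smooth_circle L \<Longrightarrow> \<phi> \<in> L2_circle L"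
  by (intro abs_cont_deriv_L2[OF smooth_abs_cont_deriv])

text \<open>Du Bois-Reymond's lemma: any smooth \<open>\<phi>\<close> becomes the derivative of a
  test function once its mean is subtracted. Orthogonality to such derivatives says that
  \<open>w\<close> minus its mean is orthogonal to every \<open>\<phi>\<close>.\<close>

lemma weak_deriv_zero_imp_const:
  assumes w: "w \<in> L2_circle L"
    and orth: "\<And>\<phi>. \<phi> \<in> smooth_circle L \<Longrightarrow> (LINT s|M. w s * deriv \<phi> s) = 0"
  shows "AE s in M. w s = (LINT s|M. w s) / L"
proof -
  define k where "k = (LINT s|M. w s) / L"
  note wi = L2_circle_integrable[OF w]
  have "AE s in M. w s - k = 0"
  proof (rule orthogonal_eq_0)
    show "integrable M (\<lambda>s. w s - k)" using wi by simp
    fix \<phi> assume \<phi>: "\<phi> \<in> smooth_circle L"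
    define m where "m = (LINT s|M. \<phi> s) / L"
    note \<phi>i = L2_circle_integrable[OF smooth_L2[OF \<phi>]]
    note w\<phi> = L2_circle_mult_integrable[OF w smooth_L2[OF \<phi>]]
    have "(LINT s|M. \<phi> s - m) = 0"
      using \<phi>i L_pos measure_M by (simp add: m_def)
    from smooth_antiderivative[OF smooth_diff_const[OF \<phi>] this]
    obtain \<Phi> where "\<Phi> \<in> smooth_circle L" "deriv \<Phi> = (\<lambda>s. \<phi> s - m)" by blast
    with orth[of \<Phi>] have "(LINT s|M. w s * \<phi> s - m * w s) = 0"
      by (simp add: algebra_simps)
    then have "(LINT s|M. w s * \<phi> s) = m * (LINT s|M. w s)" using wi w\<phi> by simp
    moreover have "(LINT s|M. (w s - k) * \<phi> s) = (LINT s|M. w s * \<phi> s) - k * (LINT s|M. \<phi> s)"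
      using w\<phi> \<phi>i by (simp add: left_diff_distrib)
    ultimately show "(LINT s|M. (w s - k) * \<phi> s) = 0" by (simp add: m_def k_def)
  qed
  then show ?thesis by (simp add: k_def)
qed

lemma abs_cont_deriv_prim:
  assumes g: "g \<in> L2_circle L" and mean: "(LINT s|M. g s) = 0"
  shows "abs_cont_deriv (\<lambda>s. k + prim g (wrap s)) g"
  using periodic_wrap[of "\<lambda>s. k + prim g s"] g mean L_pos
  by (simp add: abs_cont_deriv_def wrap_id prim_zero)

text \<open>The periodic primitive of \<open>g\<close> has the same weak derivative as
  \<open>u\<close>, so the two differ by a constant almost everywhere. Adding that constant gives
  the representative.\<close>

lemma weak_deriv_imp_abs_cont_deriv:
  assumes wd: "has_weak_deriv L u g"
  obtains v where "abs_cont_deriv v g" "AE s in M. u s = v s"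
proof -
  have u: "u \<in> L2_circle L" and g: "g \<in> L2_circle L"
    and test: "\<And>\<phi>. \<phi> \<in> smooth_circle L \<Longrightarrow> (LINT s|M. u s * deriv \<phi> s) = - (LINT s|M. g s * \<phi> s)"
    using wd by (auto simp: has_weak_deriv_def circle_integral_eq)
  \<comment> \<open>Testing with the constant function \<open>1\<close>, which is a trigonometric
    polynomial with derivative zero.\<close>
  have "(LINT s|M. g s) = 0"
    using test[OF trig_polynomial_smooth[OF real_polynomial_function.intros(2), of 1]] by simp
  note U = abs_cont_deriv_prim[OF g this, of 0]
  define U where "U s = 0 + prim g (wrap s)" for s
  have U: "abs_cont_deriv U g" unfolding U_def by (rule U)
  define w where "w s = u s - U s" for s
  have w: "w \<in> L2_circle L"
    using L2_circle_comb[OF u abs_cont_deriv_L2[OF U], of 1 "-1"] by (simp add: w_def[abs_def])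
  define k where "k = (LINT s|M. w s) / L"
  have ae: "AE s in M. w s = k"
    unfolding k_def
  proof (rule weak_deriv_zero_imp_const[OF w])
    fix \<phi> assume \<phi>: "\<phi> \<in> smooth_circle L"
    have "(LINT s|M. U s * deriv \<phi> s) = - (LINT s|M. g s * \<phi> s)"
      using abs_cont_deriv_imp_weak_deriv[OF U]
        \<phi> by (simp add: has_weak_deriv_def circle_integral_eq)
    then show "(LINT s|M. w s * deriv \<phi> s) = 0"
      using test[OF \<phi>] L2_circle_mult_integrable[OF u smooth_L2[OF smooth_deriv[OF \<phi>]]]
        L2_circle_mult_integrable[OF abs_cont_deriv_L2[OF U] smooth_L2[OF smooth_deriv[OF \<phi>]]]
      by (simp add: w_def left_diff_distrib)
  qed
  show thesis
  proof
    show "abs_cont_deriv (\<lambda>s. U s + k) g" using abs_cont_deriv_comb[OF U abs_cont_deriv_const[of k], of 1 1] by simp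
    show "AE s in M. u s = U s + k" using ae by eventually_elim (simp add: w_def)
  qed
qed

lemma weak_deriv_unique:
  assumes g: "has_weak_deriv L u g" and h: "has_weak_deriv L v h" and uv: "AE s in M. u s = v s"
  shows "AE s in M. g s = h s"
proof -
  have L2: "u \<in> L2_circle L" "v \<in> L2_circle L" "g \<in> L2_circle L" "h \<in> L2_circle L"
    using g h by (auto simp: has_weak_deriv_def)
  have "AE s in M. g s - h s = 0"
  proof (rule orthogonal_eq_0)
    show "integrable M (\<lambda>s. g s - h s)" using L2 L2_circle_integrable by simp
    fix \<phi> assume \<phi>: "\<phi> \<in> smooth_circle L"
    have "(LINT s|M. u s * deriv \<phi> s) = (LINT s|M. v s * deriv \<phi> s)"
      using uv L2_circle_mult_integrable[OF L2(1) smooth_L2[OF smooth_deriv[OF \<phi>]]]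
        L2_circle_mult_integrable[OF L2(2) smooth_L2[OF smooth_deriv[OF \<phi>]]]
      by (intro integral_cong_AE) auto
    then have "(LINT s|M. g s * \<phi> s) = (LINT s|M. h s * \<phi> s)"
      using g h \<phi> by (auto simp: has_weak_deriv_def circle_integral_eq)
    then show "(LINT s|M. (g s - h s) * \<phi> s) = 0"
      using L2_circle_mult_integrable[OF L2(3) smooth_L2[OF \<phi>]]
        L2_circle_mult_integrable[OF L2(4) smooth_L2[OF \<phi>]]
      by (simp add: left_diff_distrib)
  qed
  then show ?thesis by eventually_elim simp
qed

section \<open>The energy form\<close>

text \<open>\<open>v\<close> is the absolutely continuous representative of the Sobolev function
  \<open>u\<close>, and \<open>g\<close> is its derivative. Keeping \<open>u\<close> as a separate
  argument lets statements about arbitrary members of \<open>H1 L\<close> be proved with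
  \<open>v\<close> and \<open>g\<close>.\<close>

definition represents :: "(real \<Rightarrow> real) \<Rightarrow> (real \<Rightarrow> real) \<Rightarrow> (real \<Rightarrow> real) \<Rightarrow> bool" where
  "represents v g u \<longleftrightarrow> abs_cont_deriv v g \<and> u \<in> L2_circle L \<and> (AE s in M. u s = v s)"

lemma representsD:
  assumes "represents v g u"
  shows "abs_cont_deriv v g" "u \<in> L2_circle L" "AE s in M. u s = v s"
  using assms by (simp_all add: represents_def)

lemma abs_cont_deriv_represents: "abs_cont_deriv v g \<Longrightarrow> represents v g v"
  by (simp add: represents_def abs_cont_deriv_L2)

lemma L2_circle_measurable_M: "g \<in> L2_circle L \<Longrightarrow> g \<in> borel_measurable M"
  by (simp add: L2_circle_iff square_integrable_measurable)

lemma represents_weak_deriv: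
  assumes r: "represents v g u" shows "has_weak_deriv L u g"
  unfolding has_weak_deriv_def circle_integral_eq
proof (intro conjI ballI representsD(2)[OF r] abs_cont_deriv_deriv_L2[OF representsD(1)[OF r]])
  fix \<phi> assume \<phi>: "\<phi> \<in> smooth_circle L"
  note int = L2_circle_mult_integrable[OF representsD(2)[OF r] smooth_L2[OF smooth_deriv[OF \<phi>]]]
    L2_circle_mult_integrable[OF abs_cont_deriv_L2[OF representsD(1)[OF r]] smooth_L2[OF smooth_deriv[OF \<phi>]]]
  have "(LINT s|M. u s * deriv \<phi> s) = (LINT s|M. v s * deriv \<phi> s)"
    using representsD(3)[OF r] int by (intro integral_cong_AE) auto
  then show "(LINT s|M. u s * deriv \<phi> s) = - (LINT s|M. g s * \<phi> s)"
    using abs_cont_deriv_imp_weak_deriv[OF representsD(1)[OF r]]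
      \<phi> by (simp add: has_weak_deriv_def circle_integral_eq)
qed

lemma represents_H1: "represents v g u \<Longrightarrow> u \<in> H1 L"
  using represents_weak_deriv unfolding H1_def by blast

lemma abs_cont_deriv_H1: "abs_cont_deriv v g \<Longrightarrow> v \<in> H1 L"
  by (rule represents_H1[OF abs_cont_deriv_represents])

lemma H1_represents:
  assumes "u \<in> H1 L" obtains v g where "represents v g u"
proof -
  obtain g where g: "has_weak_deriv L u g" using assms by (auto simp: H1_def)
  then obtain v where "abs_cont_deriv v g" "AE s in M. u s = v s" by (rule weak_deriv_imp_abs_cont_deriv)
  with g have "represents v g u" by (simp add: represents_def has_weak_deriv_def)
  then show thesis by (rule that)
qed

text \<open>Uniqueness of weak derivatives replaces the arbitrary choice in
  \<open>weak_deriv\<close> by the concrete \<open>g\<close> under every integral.\<close>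

lemma weak_deriv_represents:
  assumes r: "represents v g u"
  shows "weak_deriv L u \<in> borel_measurable M" "AE s in M. weak_deriv L u s = g s"
proof -
  have w: "has_weak_deriv L u (weak_deriv L u)"
    using someI[of "has_weak_deriv L u", OF represents_weak_deriv[OF r]] by (simp add: weak_deriv_def)
  then show "weak_deriv L u \<in> borel_measurable M"
    by (simp add: has_weak_deriv_def L2_circle_measurable_M)
  show "AE s in M. weak_deriv L u s = g s"
    by (rule weak_deriv_unique[OF w represents_weak_deriv[OF r]]) simp
qed

lemma integral_weak_deriv:
  assumes r: "represents v g u" and r': "represents v' g' u'"
  shows "circle_integral L (\<lambda>s. weak_deriv L u s * weak_deriv L u' s) = (LINT s|M. g s * g' s)"
  unfolding circle_integral_eq
proof (rule integral_cong_AE)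
  note [measurable] = weak_deriv_represents(1)[OF r] weak_deriv_represents(1)[OF r']
    abs_cont_deriv_deriv_L2[OF representsD(1)[OF r], THEN L2_circle_measurable_M]
    abs_cont_deriv_deriv_L2[OF representsD(1)[OF r'], THEN L2_circle_measurable_M]
  show "(\<lambda>s. weak_deriv L u s * weak_deriv L u' s) \<in> borel_measurable M"
    "(\<lambda>s. g s * g' s) \<in> borel_measurable M" by measurable
  show "AE s in M. weak_deriv L u s * weak_deriv L u' s = g s * g' s"
    using weak_deriv_represents(2)[OF r] weak_deriv_represents(2)[OF r'] by eventually_elim simp
qed

lemma integral_represents:
  assumes r: "represents v g u"
  shows "circle_integral L (\<lambda>s. u s * u s) = (LINT s|M. v s * v s)"
  unfolding circle_integral_eq
proof (rule integral_cong_AE)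
  note [measurable] = L2_circle_measurable_M[OF representsD(2)[OF r]]
    L2_circle_measurable_M[OF abs_cont_deriv_L2[OF representsD(1)[OF r]]]
  show "(\<lambda>s. u s * u s) \<in> borel_measurable M" "(\<lambda>s. v s * v s) \<in> borel_measurable M" by measurable
  show "AE s in M. u s * u s = v s * v s" using representsD(3)[OF r] by eventually_elim simp
qed

lemma represents_comb:
  assumes r: "represents v g u" and r': "represents v' g' u'"
  shows "represents (\<lambda>s. p * v s + q * v' s) (\<lambda>s. p * g s + q * g' s) (\<lambda>s. p * u s + q * u' s)"
  unfolding represents_def
proof (intro conjI abs_cont_deriv_comb L2_circle_comb representsD(1,2)[OF r] representsD(1,2)[OF r'])
  show "AE s in M. p * u s + q * u' s = p * v s + q * v' s"
    using representsD(3)[OF r] representsD(3)[OF r'] by eventually_elim simp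
qed

lemma represents_diff:
  assumes "represents v g u" "represents v' g' u'"
  shows "represents (\<lambda>s. v s - v' s) (\<lambda>s. g s - g' s) (\<lambda>s. u s - u' s)"
  using represents_comb[OF assms, of 1 "-1"] by simp

text \<open>\<open>u\<close> and \<open>u'\<close> may be unbounded on a null set, so
  square-integrability of their product is transferred from the bounded product
  \<open>v * v'\<close>.\<close>

lemma represents_mult:
  assumes r: "represents v g u" and r': "represents v' g' u'"
  shows "represents (\<lambda>s. v s * v' s) (\<lambda>s. v s * g' s + v' s * g s) (\<lambda>s. u s * u' s)"
proof -
  note prod = abs_cont_deriv_mult[OF representsD(1)[OF r] representsD(1)[OF r']]
  note u = representsD(2)[OF r, unfolded L2_circle_iff]
    and u' = representsD(2)[OF r', unfolded L2_circle_iff]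
  note [measurable] = u[THEN conjunct2, THEN conjunct1] u'[THEN conjunct2, THEN conjunct1]
  have meas: "(\<lambda>s. u s * u' s) \<in> borel_measurable lebesgue" by measurable
  have ae: "AE s in M. u s * u' s = v s * v' s"
    using representsD(3)[OF r] representsD(3)[OF r'] by eventually_elim simp
  have "integrable M (\<lambda>s. (u s * u' s)\<^sup>2)"
  proof (rule integrable_cong_AE_imp)
    show "integrable M (\<lambda>s. (v s * v' s)\<^sup>2)"
      using abs_cont_deriv_L2[OF prod] by (simp add: L2_circle_iff square_integrable_def)
    have "(\<lambda>s. u s * u' s) \<in> borel_measurable M" by (rule measurable_restrict_space1[OF meas])
    then show "(\<lambda>s. (u s * u' s)\<^sup>2) \<in> borel_measurable M" by measurable
    show "AE s in M. (v s * v' s)\<^sup>2 = (u s * u' s)\<^sup>2" using ae by eventually_elim simp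
  qed
  moreover have "periodic_fun_simple (\<lambda>s. u s * u' s) L"
    using u u' by (simp add: periodic_fun_simple_def)
  ultimately have "(\<lambda>s. u s * u' s) \<in> L2_circle L"
    using measurable_restrict_space1[OF meas, of "{0..<L}"] meas
    by (simp add: L2_circle_iff square_integrable_def)
  then show ?thesis using prod ae by (simp add: represents_def)
qed

lemma H1_comb: "u \<in> H1 L \<Longrightarrow> v \<in> H1 L \<Longrightarrow> (\<lambda>s. p * u s + q * v s) \<in> H1 L"
  using represents_H1[OF represents_comb] by (elim H1_represents)

lemma H1_mult: "u \<in> H1 L \<Longrightarrow> v \<in> H1 L \<Longrightarrow> (\<lambda>s. u s * v s) \<in> H1 L"
  using represents_H1[OF represents_mult] by (elim H1_represents)

lemma H1_norm_represents:
  assumes "represents v g u"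
  shows "(H1_norm L u)\<^sup>2 = (LINT s|M. (g s)\<^sup>2) + (LINT s|M. (v s)\<^sup>2)"
proof -
  have "H1_inner L u u = (LINT s|M. (g s)\<^sup>2) + (LINT s|M. (v s)\<^sup>2)"
    using integral_weak_deriv[OF assms assms] integral_represents[OF assms]
    by (simp add: H1_inner_def power2_eq_square)
  moreover have "0 \<le> (LINT s|M. (g s)\<^sup>2) + (LINT s|M. (v s)\<^sup>2)" by simp
  ultimately show ?thesis by (simp add: H1_norm_def)
qed

lemma H1_dual_comb:
  assumes f: "f \<in> H1_dual L" and "u \<in> H1 L" "v \<in> H1 L"
  shows "f (\<lambda>s. p * u s + q * v s) = p * f u + q * f v"
proof -
  have "(\<lambda>s. p * u s) \<in> H1 L" "(\<lambda>s. q * v s) \<in> H1 L"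
    using H1_comb[of u u p 0] H1_comb[of v v q 0] assms by simp_all
  moreover have "f (\<lambda>s. u s + v s) = f u + f v" if "u \<in> H1 L" "v \<in> H1 L" for u v
    using f that unfolding H1_dual_def by blast
  ultimately have "f (\<lambda>s. p * u s + q * v s) = f (\<lambda>s. p * u s) + f (\<lambda>s. q * v s)" by blast
  moreover have "f (\<lambda>s. p * u s) = p * f u" "f (\<lambda>s. q * v s) = q * f v"
    using f assms(2,3) unfolding H1_dual_def by blast+
  ultimately show ?thesis by simp
qed

text \<open>The difference \<open>u - v\<close> has zero \<open>H1_norm\<close>, so the bound in
  \<open>H1_dual\<close> forces the functional to vanish on it. Hence functionals may be evaluated
  on continuous representatives.\<close>

lemma H1_dual_represents:
  assumes f: "f \<in> H1_dual L" and r: "represents v g u"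
  shows "f u = f v"
proof -
  have d: "represents (\<lambda>s. 0) (\<lambda>s. 0) (\<lambda>s. u s - v s)"
    using represents_diff[OF r abs_cont_deriv_represents[OF representsD(1)[OF r]]] by simp
  obtain C where "\<And>w. w \<in> H1 L \<Longrightarrow> \<bar>f w\<bar> \<le> C * H1_norm L w"
    using f unfolding H1_dual_def by blast
  then have "\<bar>f (\<lambda>s. u s - v s)\<bar> \<le> C * H1_norm L (\<lambda>s. u s - v s)"
    using represents_H1[OF d] by blast
  also have "H1_norm L (\<lambda>s. u s - v s) = 0" using H1_norm_represents[OF d] by simp
  finally have "f (\<lambda>s. u s - v s) = 0" by simp
  then show ?thesis
    using H1_dual_comb[OF f represents_H1[OF r] abs_cont_deriv_H1[OF representsD(1)[OF r]], of 1 "-1"]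
      by simp
qed

text \<open>Limits supplied by \<open>L2_complete\<close> live on one period only, while
  \<open>L2_circle\<close> asks for periodic measurable functions on the line. Passing to a Borel
  version comes before the composition with \<open>wrap\<close>, because that composition preserves
  Borel measurability.\<close>

lemma L2_circle_version:
  assumes h: "square_integrable M h"
  obtains g where "g \<in> L2_circle L" "AE s in M. g s = h s"
proof -
  define h1 where "h1 s = indicator {0..<L} s *\<^sub>R h s" for s
  have "h1 \<in> borel_measurable lebesgue"
    using square_integrable_measurable[OF h] borel_measurable_restrict_space_iff[of "{0..<L}" lebesgue h]
    by (simp add: h1_def[abs_def])
  then obtain h2 where h2: "h2 \<in> borel_measurable lborel" and ae: "AE s in lborel. h1 s = h2 s"
    using completion_ex_borel_measurable_real by blast
  have [measurable]: "h2 \<in> borel_measurable borel" using h2 by simp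
  define g where "g s = h2 (wrap s)" for s
  have [measurable]: "g \<in> borel_measurable borel" unfolding g_def by measurable
  have eq: "AE s in M. g s = h s"
    using AE_completion[OF ae] unfolding AE_M_iff
    by eventually_elim (auto simp: g_def h1_def wrap_id)
  have "integrable M (\<lambda>s. (g s)\<^sup>2)"
  proof (rule integrable_cong_AE_imp)
    show "integrable M (\<lambda>s. (h s)\<^sup>2)" using h by (simp add: square_integrable_def)
    have "(\<lambda>s. (g s)\<^sup>2) \<in> borel_measurable borel" by measurable
    then show "(\<lambda>s. (g s)\<^sup>2) \<in> borel_measurable M" by (rule borel_imp_M)
    show "AE s in M. (h s)\<^sup>2 = (g s)\<^sup>2" using eq by eventually_elim simp
  qed
  then have "g \<in> L2_circle L"
    using periodic_wrap[of h2] borel_imp_M[of g] borel_imp_lebesgue[of g]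
    by (simp add: L2_circle_iff square_integrable_def g_def[abs_def])
  with eq show thesis by (intro that)
qed

end

section \<open>Coercivity, completeness and the weak solution\<close>

locale circle_potential = circle +
  fixes c :: "(real \<Rightarrow> real) \<Rightarrow> real"
  assumes c_dual: "c \<in> H1_dual L" and c_nonneg: "H1_dual_nonneg L c" and c_pos: "0 < c (\<lambda>s. 1)"
begin

definition Q :: "(real \<Rightarrow> real) \<Rightarrow> (real \<Rightarrow> real) \<Rightarrow> real" where
  "Q u v = circle_integral L (\<lambda>s. weak_deriv L u s * weak_deriv L v s) + c (\<lambda>s. u s * v s)"

lemma Q_represents:
  assumes "represents v g u" "represents v' g' u'"
  shows "Q u u' = (LINT s|M. g s * g' s) + c (\<lambda>s. v s * v' s)"
  unfolding Q_def integral_weak_deriv[OF assms] H1_dual_represents[OF c_dual represents_mult[OF assms]]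
    ..

lemma c_mono:
  assumes "abs_cont_deriv u g" "abs_cont_deriv v h" and "\<And>s. u s \<le> v s" shows "c u \<le> c v"
proof -
  note H = abs_cont_deriv_H1[OF assms(1)] abs_cont_deriv_H1[OF assms(2)]
  have "(\<lambda>s. v s - u s) \<in> H1 L" using H1_comb[OF H(2,1), of 1 "-1"] by simp
  then have "0 \<le> c (\<lambda>s. v s - u s)" using c_nonneg assms(3) by (simp add: H1_dual_nonneg_def)
  then show ?thesis using H1_dual_comb[OF c_dual H(2,1), of 1 "-1"] by simp
qed

lemma c_const: "c (\<lambda>s. k) = k * c (\<lambda>s. 1)"
  using H1_dual_comb[OF c_dual abs_cont_deriv_H1[OF abs_cont_deriv_const[of 1]] abs_cont_deriv_H1[OF abs_cont_deriv_const[of 1]], of k 0]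
  by simp

lemma c_square_nonneg: "abs_cont_deriv v g \<Longrightarrow> 0 \<le> c (\<lambda>s. v s * v s)"
  using c_mono[OF abs_cont_deriv_const[of 0] abs_cont_deriv_mult[of v g v g]] c_const[of 0] by simp

lemma quadratic_form_Q: "quadratic_form (H1 L) Q"
proof
  show "H1 L \<noteq> {}" using abs_cont_deriv_H1[OF abs_cont_deriv_const] by blast
  fix u v w and p q :: real assume u: "u \<in> H1 L" and v: "v \<in> H1 L"
  show "(\<lambda>s. p * u s + q * v s) \<in> H1 L" using u v by (rule H1_comb)
  show "Q u v = Q v u" unfolding Q_def by (simp add: mult.commute)
  show "0 \<le> Q u u"
  proof -
    obtain z g where r: "represents z g u" using u by (rule H1_represents)
    show ?thesis using c_square_nonneg[OF representsD(1)[OF r]] unfolding Q_represents[OF r r]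
      by (simp add: add_nonneg_nonneg)
  qed
  assume w: "w \<in> H1 L"
  obtain u' ug where ru: "represents u' ug u" using u by (rule H1_represents)
  obtain v' vg where rv: "represents v' vg v" using v by (rule H1_represents)
  obtain w' wg where rw: "represents w' wg w" using w by (rule H1_represents)
  note int = L2_circle_mult_integrable[OF abs_cont_deriv_deriv_L2[OF representsD(1)[OF ru]] abs_cont_deriv_deriv_L2[OF representsD(1)[OF rw]]]
    L2_circle_mult_integrable[OF abs_cont_deriv_deriv_L2[OF representsD(1)[OF rv]] abs_cont_deriv_deriv_L2[OF representsD(1)[OF rw]]]
  have "(LINT s|M. (p * ug s + q * vg s) * wg s) = (LINT s|M. p * (ug s * wg s) + q * (vg s * wg s))"
    by (simp add: distrib_right mult.assoc)
  also have "\<dots> = p * (LINT s|M. ug s * wg s) + q * (LINT s|M. vg s * wg s)" using int by simp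
  moreover have "c (\<lambda>s. (p * u' s + q * v' s) * w' s) = c (\<lambda>s. p * (u' s * w' s) + q * (v' s * w' s))"
    by (simp add: distrib_right mult.assoc)
  moreover have "\<dots> = p * c (\<lambda>s. u' s * w' s) + q * c (\<lambda>s. v' s * w' s)"
    by (intro H1_dual_comb c_dual H1_mult abs_cont_deriv_H1[OF representsD(1)[OF ru]]
        abs_cont_deriv_H1[OF representsD(1)[OF rv]] abs_cont_deriv_H1[OF representsD(1)[OF rw]])
  ultimately show "Q (\<lambda>s. p * u s + q * v s) w = p * Q u w + q * Q v w"
    unfolding Q_represents[OF ru rw] Q_represents[OF rv rw] Q_represents[OF represents_comb[OF ru rv] rw]
    by (simp add: algebra_simps)
qed

sublocale quadratic_form "H1 L" Q by (rule quadratic_form_Q)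

text \<open>The first summand pays for the oscillation, the second for the mass of \<open>c\<close>.
  Both factors \<open>2\<close> come from splitting \<open>v t\<close> into \<open>v s\<close> and
  \<open>v t - v s\<close> and squaring.\<close>

definition K :: real where "K = 2 * L + 2 / c (\<lambda>s. 1)"

lemma K_pos: "0 < K"
  using L_pos c_pos by (simp add: K_def add_pos_pos)

text \<open>In dimension one the oscillation is controlled by the derivative alone; since \<open>c\<close> has positive
  mass, \<open>c (v * v)\<close> controls the minimum of \<open>v\<^sup>2\<close>.\<close>

lemma coercive:
  assumes r: "represents v g u"
  shows "(LINT s|M. (g s)\<^sup>2) \<le> Q u u" "(v t)\<^sup>2 \<le> K * Q u u"
proof -
  note v = representsD(1)[OF r]
  have Q: "Q u u = (LINT s|M. (g s)\<^sup>2) + c (\<lambda>s. v s * v s)"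
    using Q_represents[OF r r] by (simp add: power2_eq_square)
  show "(LINT s|M. (g s)\<^sup>2) \<le> Q u u" unfolding Q using c_square_nonneg[OF v] by simp
  define D where "D = L * (LINT s|M. (g s)\<^sup>2)"
  have "(v t)\<^sup>2 / 2 - D \<le> v s * v s" for s
  proof -
    have "(v t)\<^sup>2 \<le> 2 * (v s)\<^sup>2 + 2 * (v t - v s)\<^sup>2"
      \<comment> \<open>This square is exactly the difference of the two sides.\<close>
      using zero_le_power2[of "v t - 2 * v s"] by (simp add: power2_eq_square algebra_simps)
    then show ?thesis using abs_cont_deriv_osc_square[OF v, of t s] by (simp add: D_def power2_eq_square)
  qed
  \<comment> \<open>With \<open>t\<close> fixed the left side is a constant function of
    \<open>s\<close>, so positivity of \<open>c\<close> turns the pointwise bound into one that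
    involves only the mass \<open>c (\<lambda>s. 1)\<close>.\<close>
  then have "c (\<lambda>s. (v t)\<^sup>2 / 2 - D) \<le> c (\<lambda>s. v s * v s)"
    by (rule c_mono[OF abs_cont_deriv_const abs_cont_deriv_mult[OF v v]])
  then have "((v t)\<^sup>2 / 2 - D) * c (\<lambda>s. 1) \<le> c (\<lambda>s. v s * v s)"
    unfolding c_const[of "(v t)\<^sup>2 / 2 - D"] .
  then have "(v t)\<^sup>2 / 2 - D \<le> c (\<lambda>s. v s * v s) / c (\<lambda>s. 1)" using c_pos by (simp add: pos_le_divide_eq)
  then have "(v t)\<^sup>2 \<le> 2 * L * (LINT s|M. (g s)\<^sup>2) + 2 / c (\<lambda>s. 1) * c (\<lambda>s. v s * v s)"
    by (simp add: D_def)
  also have "\<dots> \<le> K * (LINT s|M. (g s)\<^sup>2) + K * c (\<lambda>s. v s * v s)"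
    unfolding K_def using L_pos c_pos c_square_nonneg[OF v]
    by (intro add_mono mult_right_mono) auto
  finally show "(v t)\<^sup>2 \<le> K * Q u u" by (simp add: Q distrib_left)
qed

text \<open>The converse of coercivity, with the value at the single point \<open>0\<close> standing
  in for the size of \<open>v\<close>. It reduces convergence in \<open>Q\<close> to mean-square
  convergence of derivatives and convergence of one real sequence.\<close>

lemma Q_upper_bound:
  assumes r: "represents v g u"
  shows "Q u u \<le> (1 + 2 * L * c (\<lambda>s. 1)) * (LINT s|M. (g s)\<^sup>2) + 2 * c (\<lambda>s. 1) * (v 0)\<^sup>2"
proof -
  note v = representsD(1)[OF r]
  define D where "D = L * (LINT s|M. (g s)\<^sup>2)"
  have "v s * v s \<le> 2 * (v 0)\<^sup>2 + 2 * D" for s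
  proof -
    have "(v s)\<^sup>2 \<le> 2 * (v 0)\<^sup>2 + 2 * (v s - v 0)\<^sup>2"
      using zero_le_power2[of "v s - 2 * v 0"] by (simp add: power2_eq_square algebra_simps)
    then show ?thesis using abs_cont_deriv_osc_square[OF v, of s 0] by (simp add: D_def power2_eq_square)
  qed
  then have "c (\<lambda>s. v s * v s) \<le> c (\<lambda>s. 2 * (v 0)\<^sup>2 + 2 * D)"
    by (rule c_mono[OF abs_cont_deriv_mult[OF v v] abs_cont_deriv_const])
  then have "c (\<lambda>s. v s * v s) \<le> (2 * (v 0)\<^sup>2 + 2 * D) * c (\<lambda>s. 1)"
    unfolding c_const[of "2 * (v 0)\<^sup>2 + 2 * D"] .
  then show ?thesis using Q_represents[OF r r] by (simp add: D_def power2_eq_square algebra_simps)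
qed

text \<open>Supplies the boundedness that the representation theorem asks for. Integrating the
  pointwise bound of \<open>coercive\<close> over the period gives the factor \<open>L * K\<close>
  for the function, and the derivative contributes the \<open>1\<close>.\<close>

lemma H1_dual_Q_bound:
  assumes f: "f \<in> H1_dual L"
  shows "\<exists>C. \<forall>u\<in>H1 L. (f u)\<^sup>2 \<le> C * Q u u"
proof -
  obtain C where C: "\<And>u. u \<in> H1 L \<Longrightarrow> \<bar>f u\<bar> \<le> C * H1_norm L u"
    using f unfolding H1_dual_def by blast
  have "(f u)\<^sup>2 \<le> C\<^sup>2 * (1 + L * K) * Q u u" if u: "u \<in> H1 L" for u
  proof -
    obtain v g where r: "represents v g u" using u by (rule H1_represents)
    have "(LINT s|M. (v s)\<^sup>2) \<le> (LINT s|M. K * Q u u)"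
      using L2_circle_mult_integrable[OF abs_cont_deriv_L2[OF representsD(1)[OF r]] abs_cont_deriv_L2[OF representsD(1)[OF r]]]
      by (intro integral_mono coercive(2)[OF r]) (auto simp: power2_eq_square)
    also have "\<dots> = L * K * Q u u" using measure_M by simp
    finally have "(H1_norm L u)\<^sup>2 \<le> (1 + L * K) * Q u u"
      unfolding H1_norm_represents[OF r] using coercive(1)[OF r] by (simp add: distrib_right)
    then have "C\<^sup>2 * (H1_norm L u)\<^sup>2 \<le> C\<^sup>2 * ((1 + L * K) * Q u u)" by (rule mult_left_mono) simp
    moreover have "(f u)\<^sup>2 \<le> (C * H1_norm L u)\<^sup>2"
      using power_mono[OF C[OF u], of 2] by simp
    ultimately show ?thesis by (simp add: power_mult_distrib mult.assoc)
  qed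
  then show ?thesis by blast
qed

text \<open>By coercivity the derivatives are Cauchy in mean square and the values at
  \<open>0\<close> are Cauchy in the reals. The limit function is rebuilt from these two limits as
  \<open>k\<close> plus the primitive of \<open>g\<close>.\<close>

lemma Q_complete:
  assumes X: "\<And>n. X n \<in> H1 L"
    and cauchy: "\<And>e. e > 0 \<Longrightarrow>
      \<exists>N. \<forall>m\<ge>N. \<forall>n\<ge>N. Q (\<lambda>s. X m s - X n s) (\<lambda>s. X m s - X n s) < e"
  shows "\<exists>u\<in>H1 L. (\<lambda>n. Q (\<lambda>s. X n s - u s) (\<lambda>s. X n s - u s)) \<longlonglongrightarrow> 0"
proof -
  have "\<forall>n. \<exists>v g. represents v g (X n)" using H1_represents[OF X] by metis
  then obtain V G where r: "\<And>n. represents (V n) (G n) (X n)" by metis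
  note d = represents_diff[OF r r]
  have "\<exists>h. square_integrable M h \<and> (\<lambda>n. LINT s|M. (G n s - h s)\<^sup>2) \<longlonglongrightarrow> 0"
  proof (rule L2_complete)
    show "square_integrable M (G n)" for n by (rule abs_cont_deriv_square_integrable[OF representsD(1)[OF r]])
    fix e :: real assume "e > 0"
    from cauchy[OF this] coercive(1)[OF d]
    show "\<exists>N. \<forall>m\<ge>N. \<forall>n\<ge>N. (LINT s|M. (G m s - G n s)\<^sup>2) < e" by (meson le_less_trans)
  qed
  then obtain h where h: "square_integrable M h" and lim_h: "(\<lambda>n. LINT s|M. (G n s - h s)\<^sup>2) \<longlonglongrightarrow> 0"
    by blast
  obtain g where g: "g \<in> L2_circle L" and gh: "AE s in M. g s = h s"
    using L2_circle_version[OF h] .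
  have gsq: "square_integrable M g" using g by (simp add: L2_circle_iff)
  have eq: "(LINT s|M. (G n s - h s)\<^sup>2) = (LINT s|M. (G n s - g s)\<^sup>2)" for n
  proof (rule integral_cong_AE)
    note [measurable] = square_integrable_measurable[OF h] square_integrable_measurable[OF gsq]
      square_integrable_measurable[OF abs_cont_deriv_square_integrable[OF representsD(1)[OF r]]]
    show "(\<lambda>s. (G n s - h s)\<^sup>2) \<in> borel_measurable M" "(\<lambda>s. (G n s - g s)\<^sup>2) \<in> borel_measurable M"
      by measurable
    show "AE s in M. (G n s - h s)\<^sup>2 = (G n s - g s)\<^sup>2" using gh by eventually_elim simp
  qed
  note lim_g = lim_h[unfolded eq]
  \<comment> \<open>The primitive of \<open>g\<close> closes up on the circle only if
    \<open>g\<close> has mean zero. Each \<open>G n\<close> has mean zero, and Cauchy-Schwarz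
    carries this to the limit.\<close>
  have "(LINT s|M. g s)\<^sup>2 \<le> L * (LINT s|M. (G n s - g s)\<^sup>2)" for n
  proof -
    have "(LINT s|M. G n s - g s) = - (LINT s|M. g s)"
      using abs_cont_deriv_deriv_mean[OF representsD(1)[OF r]]
        abs_cont_deriv_integrable[OF representsD(1)[OF r]]
        L2_circle_integrable[OF g] by simp
    then have "\<bar>LINT s|M. g s\<bar> \<le> (LINT s|M. \<bar>G n s - g s\<bar>)"
      using integral_abs_bound[of M "\<lambda>s. G n s - g s"] by simp
    then have "(LINT s|M. g s)\<^sup>2 \<le> (LINT s|M. \<bar>G n s - g s\<bar>)\<^sup>2"
      using power_mono[of "\<bar>LINT s|M. g s\<bar>" _ 2] by simp
    also have "\<dots> \<le> L * (LINT s|M. (G n s - g s)\<^sup>2)"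
      using integral_square_bound[OF square_integrable_diff[OF abs_cont_deriv_square_integrable[OF representsD(1)[OF r]] gsq]]
        measure_M by simp
    finally show ?thesis .
  qed
  then have "(LINT s|M. g s)\<^sup>2 \<le> L * 0"
    by (intro tendsto_lowerbound[OF tendsto_mult_left[OF lim_g]]) auto
  then have mean: "(LINT s|M. g s) = 0" by simp
  have "Cauchy (\<lambda>n. V n 0)"
  proof (rule metric_CauchyI)
    fix e :: real assume e: "e > 0"
    then obtain N where N: "\<And>m n. m \<ge> N \<Longrightarrow> n \<ge> N \<Longrightarrow>
        Q (\<lambda>s. X m s - X n s) (\<lambda>s. X m s - X n s) < e\<^sup>2 / K"
      using cauchy[of "e\<^sup>2 / K"] K_pos by auto
    have "dist (V m 0) (V n 0) < e" if "m \<ge> N" "n \<ge> N" for m n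
    proof -
      have "(V m 0 - V n 0)\<^sup>2 \<le> K * Q (\<lambda>s. X m s - X n s) (\<lambda>s. X m s - X n s)"
        by (rule coercive(2)[OF d])
      also have "\<dots> < e\<^sup>2" using N[OF that] K_pos by (simp add: field_simps)
      finally have "\<bar>V m 0 - V n 0\<bar>\<^sup>2 < e\<^sup>2" by simp
      from power2_less_imp_less[OF this] e show ?thesis by (simp add: dist_real_def)
    qed
    then show "\<exists>N. \<forall>m\<ge>N. \<forall>n\<ge>N. dist (V m 0) (V n 0) < e" by blast
  qed
  then obtain k where k: "(\<lambda>n. V n 0) \<longlonglongrightarrow> k" by (auto simp: Cauchy_convergent_iff convergent_def)
  define u where "u s = k + prim g (wrap s)" for s
  have u: "abs_cont_deriv u g" unfolding u_def by (rule abs_cont_deriv_prim[OF g mean])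
  have u0: "u 0 = k" using L_pos by (simp add: u_def wrap_id prim_zero)
  note du = represents_diff[OF r abs_cont_deriv_represents[OF u]]
  have "(\<lambda>n. Q (\<lambda>s. X n s - u s) (\<lambda>s. X n s - u s)) \<longlonglongrightarrow> 0"
  proof (rule tendsto_sandwich[OF always_eventually always_eventually tendsto_const])
    show "\<forall>n. 0 \<le> Q (\<lambda>s. X n s - u s) (\<lambda>s. X n s - u s)"
      using nonneg[OF represents_H1[OF du]] by blast
    show "\<forall>n. Q (\<lambda>s. X n s - u s) (\<lambda>s. X n s - u s)
      \<le> (1 + 2 * L * c (\<lambda>s. 1)) * (LINT s|M. (G n s - g s)\<^sup>2) + 2 * c (\<lambda>s. 1) * (V n 0 - k)\<^sup>2"
      using Q_upper_bound[OF du] unfolding u0 by blast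
    have "(\<lambda>n. (1 + 2 * L * c (\<lambda>s. 1)) * (LINT s|M. (G n s - g s)\<^sup>2) + 2 * c (\<lambda>s. 1) * (V n 0 - k)\<^sup>2)
      \<longlonglongrightarrow> (1 + 2 * L * c (\<lambda>s. 1)) * 0 + 2 * c (\<lambda>s. 1) * (k - k)\<^sup>2"
      by (intro tendsto_intros lim_g k)
    then show "(\<lambda>n. (1 + 2 * L * c (\<lambda>s. 1)) * (LINT s|M. (G n s - g s)\<^sup>2) + 2 * c (\<lambda>s. 1) * (V n 0 - k)\<^sup>2)
      \<longlonglongrightarrow> 0" by simp
  qed
  then show ?thesis using abs_cont_deriv_H1[OF u] by blast
qed

lemma weak_solution_iff: "weak_solution L c f u \<longleftrightarrow> u \<in> H1 L \<and> (\<forall>v\<in>H1 L. Q u v = f v)"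
  by (simp add: weak_solution_def Q_def)

lemma weak_solution_exists:
  assumes f: "f \<in> H1_dual L" shows "\<exists>u. weak_solution L c f u"
proof -
  obtain C where "\<And>u. u \<in> H1 L \<Longrightarrow> (f u)\<^sup>2 \<le> C * Q u u"
    using H1_dual_Q_bound[OF f] by blast
  from Riesz_representation[OF H1_dual_comb[OF f] this Q_complete]
  show ?thesis unfolding weak_solution_iff by blast
qed

text \<open>\<open>Q\<close> vanishes on the difference of two solutions, and the pointwise half of
  \<open>coercive\<close> then makes its continuous representative zero everywhere. Periodicity
  extends the equality from one period to the line.\<close>

lemma weak_solution_unique:
  assumes u: "weak_solution L c f u" and w: "weak_solution L c f w"
  shows "AE s in lebesgue. u s = w s"
proof -
  have H: "u \<in> H1 L" "w \<in> H1 L" using u w by (simp_all add: weak_solution_iff)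
  define z where "z s = u s - w s" for s
  have z: "z \<in> H1 L" unfolding z_def using H by (rule diff)
  have "Q z z = 0"
    using diff_left[OF H z] u w z by (simp add: weak_solution_iff z_def[abs_def])
  obtain v g where r: "represents v g z" using z by (rule H1_represents)
  have "v s = 0" for s using coercive(2)[OF r, of s] \<open>Q z z = 0\<close> by simp
  then have "AE s in M. z s = 0" using representsD(3)[OF r] by simp
  then have "AE s in lebesgue. z s = 0"
    using representsD(2)[OF r] by (intro AE_periodic) (auto simp: L2_circle_iff)
  then show ?thesis by eventually_elim (simp add: z_def)
qed

end

text \<open>The interval \<open>{0..<L}\<close> is empty here, so every
  \<open>circle_integral\<close> is \<open>0\<close>. Constants are periodic for any
  \<open>L\<close>, so \<open>\<lambda>s. 1\<close> still belongs to \<open>H1 L\<close> and the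
  bound on \<open>c\<close> applies to it.\<close>

lemma H1_dual_degenerate:
  assumes c: "c \<in> H1_dual L" and L: "L \<le> 0"
  shows "c (\<lambda>s. 1) = 0"
proof -
  have [simp]: "circle_integral L g = 0" for g
    using L by (simp add: circle_integral_def set_lebesgue_integral_def)
  have L2: "(\<lambda>s. k) \<in> L2_circle L" for k
    using L by (simp add: L2_circle_def periodic_fun_simple_def set_integrable_def)
  have "has_weak_deriv L (\<lambda>s. 1) (\<lambda>s. 0)"
    using L2 by (simp add: has_weak_deriv_def)
  then have "(\<lambda>s. 1) \<in> H1 L" by (auto simp: H1_def)
  then obtain C where "\<bar>c (\<lambda>s. 1)\<bar> \<le> C * H1_norm L (\<lambda>s. 1)"
    using c unfolding H1_dual_def by blast
  then show ?thesis by (simp add: H1_norm_def H1_inner_def)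
qed

theorem theorem2p6:
  fixes \<Omega> :: "(real ^ 'n) set"
    and X :: "real \<Rightarrow> real ^ 'n"
    and a b L :: real
    and f c :: "(real \<Rightarrow> real) \<Rightarrow> real"
  assumes "real_algebraic_curve \<Omega>"
    and "closed_parametrization 1 a b X \<Omega>"
    and "L = curve_length a b X"
    and "f \<in> H1_dual L"
    and "c \<in> H1_dual L"
    and "H1_dual_nonneg L c"
    and "c (\<lambda>s. 1) > 0"
  shows "(\<exists>u. weak_solution L c f u) \<and>
         (\<forall>u w. weak_solution L c f u \<and> weak_solution L c f w \<longrightarrow>
            (AE s in lebesgue. u s = w s))"
proof -
  have "0 < L" using H1_dual_degenerate[OF assms(5)] assms(7) by force
  then interpret circle_potential L c using assms(5-7) by unfold_locales
  show ?thesis using weak_solution_exists[OF assms(4)] weak_solution_unique by blast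
qed

end
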